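(* Let $n\geq 2$ be an integer, let $\alpha>0$ be a real number, and let $\omega$ be a fast majorant. If $\varphi\in\mathscr{L}_{\omega}(\mathbb{S}^{n-1})$, then $P_{\alpha}[\varphi]\in\mathscr{L}_{\omega}(\mathbb{B}^{n})$.
   Context: Notation: $\mathbb{B}^{n}=\{x\in\mathbb{R}^n: |x|<1\}$ is the open Euclidean unit ball and $\mathbb{S}^{n-1}=\partial\mathbb{B}^{n}$ is the unit sphere, where $|\cdot|$ is the Euclidean norm; $\sigma$ is the rotation-invariant positive Borel measure on $\mathbb{S}^{n-1}$ with $\sigma(\mathbb{S}^{n-1})=1$. Majorants: a continuous increasing function $\omega:[0,\infty)\to[0,\infty)$ with $\omega(0)=0$ is called a majorant if $\omega(t)/t$ is non-increasing for $t\in(0,\infty)$. A majorant $\omega$ is called fast if, for some $\lambda_{0}>0$, there is a positive constant $M$ such that $$\int_{0}^{\lambda}\frac{\omega(t)}{t}\,dt\leq M\,\omega(\lambda)\quad\text{for all } 0<\lambda<\lambda_{0}.$$ Lipschitz spaces: for a majorant $\omega$ and a subset $\Omega\subset\mathbb{R}^{n}$, a function $f:\Omega\to\mathbb{R}$ belongs to $\mathscr{L}_{\omega}(\Omega)$ if there is a positive constant $M$ such that $|f(x)-f(y)|\leq M\,\omega(|x-y|)$ for all $x,y\in\Omega$. Dirichlet solution: for $\alpha>-1$ and $x\in\mathbb{B}^n$, let $\delta_{\alpha}(x)=(1-|x|^{2})^{\alpha}$ and let $$\Delta_{\alpha}=\mathrm{div}(\delta_{\alpha}^{-1}\nabla)+\alpha(n-2-\alpha)\delta_{\alpha+1}^{-1}.$$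 For a function $\varphi$ on $\mathbb{S}^{n-1}$, $P_{\alpha}[\varphi]$ denotes the Dirichlet solution of $\varphi$ over $\mathbb{B}^n$ for $\Delta_\alpha$, that is, $\Delta_{\alpha}P_{\alpha}[\varphi]=0$ in $\mathbb{B}^{n}$ and $P_{\alpha}[\varphi]=\varphi$ on $\mathbb{S}^{n-1}$. For $\varphi\in C(\mathbb{S}^{n-1})$ it is given by $$P_{\alpha}[\varphi](x)=\int_{\mathbb{S}^{n-1}}\mathbf{P}_{\alpha}(x,\zeta)\varphi(\zeta)\,d\sigma(\zeta),\quad x\in\mathbb{B}^{n},$$ where $$\mathbf{P}_{\alpha}(x,\zeta)=C_{\alpha}\frac{(1-|x|^{2})^{1+\alpha}}{|x-\zeta|^{n+\alpha}},\qquad C_{\alpha}=\frac{\Gamma\left(\frac{n+\alpha}{2}\right)\Gamma\left(1+\frac{\alpha}{2}\right)}{\Gamma\left(\frac{n}{2}\right)\Gamma(1+\alpha)},$$ with $\Gamma$ the Gamma function, and $P_\alpha[\varphi]$ is continuous on $\overline{\mathbb{B}^n}$. *)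

theory Defs
  imports "HOL-Analysis.Analysis"
begin

(* "Increasing" is strict, in contrast with "non-increasing" for omega(t)/t.
   In particular omega = 0 is not a majorant. *)
definition majorant :: "(real \<Rightarrow> real) \<Rightarrow> bool" where
  "majorant \<omega> \<longleftrightarrow>
     continuous_on {0..} \<omega> \<and> strict_mono_on {0..} \<omega> \<and> (\<forall>t\<ge>0. \<omega> t \<ge> 0) \<and> \<omega> 0 = 0 \<and>
     antimono_on {0<..} (\<lambda>t. \<omega> t / t)"

(* The integral is taken in ennreal, so the bound includes its convergence at 0. *)
definition fast_majorant :: "(real \<Rightarrow> real) \<Rightarrow> bool" where
  "fast_majorant \<omega> \<longleftrightarrow> majorant \<omega> \<and>
     (\<exists>r\<^sub>0>0. \<exists>M>0. \<forall>r. 0 < r \<and> r < r\<^sub>0 \<longrightarrow>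
        (\<integral>\<^sup>+t\<in>{0<..<r}. ennreal (\<omega> t / t) \<partial>lborel) \<le> ennreal (M * \<omega> r))"

(* Functions are total; only their values on \<Omega> matter. *)
definition Lipschitz_space ::
    "(real \<Rightarrow> real) \<Rightarrow> (real^'n) set \<Rightarrow> (real^'n \<Rightarrow> real) set" where
  "Lipschitz_space \<omega> \<Omega> =
     {f. \<exists>M>0. \<forall>x\<in>\<Omega>. \<forall>y\<in>\<Omega>. \<bar>f x - f y\<bar> \<le> M * \<omega> (norm (x - y))}"

(* These conditions determine \<sigma> uniquely when n \<ge> 2. *)
definition normalized_sphere_measure :: "(real^'n) measure \<Rightarrow> bool" where
  "normalized_sphere_measure \<sigma> \<longleftrightarrow>
     sets \<sigma> = sets (restrict_space borel (sphere 0 1)) \<and>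
     emeasure \<sigma> (sphere 0 1) = 1 \<and>
     (\<forall>T. orthogonal_transformation T \<and> det (matrix T) = 1 \<longrightarrow>
        (\<forall>A\<in>sets \<sigma>. emeasure \<sigma> (T ` A) = emeasure \<sigma> A))"

definition poisson_const :: "nat \<Rightarrow> real \<Rightarrow> real" where
  "poisson_const n \<alpha> =
     Gamma ((real n + \<alpha>) / 2) * Gamma (1 + \<alpha> / 2) / (Gamma (real n / 2) * Gamma (1 + \<alpha>))"

definition poisson_kernel :: "real \<Rightarrow> real^'n \<Rightarrow> real^'n \<Rightarrow> real" where
  "poisson_kernel \<alpha> x \<zeta> =
     poisson_const CARD('n) \<alpha> *
       ((1 - (norm x)\<^sup>2) powr (1 + \<alpha>) / norm (x - \<zeta>) powr (real CARD('n) + \<alpha>))"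

(* For continuous \<phi> and x in the open unit ball, this is the explicit form of the solution of
   the Dirichlet problem  \<Delta>\<^sub>\<alpha> u = 0 in the ball, u = \<phi> on the sphere,  where
   \<Delta>\<^sub>\<alpha> = div((1-|x|^2)^(-\<alpha>) grad) + \<alpha> (n-2-\<alpha>) (1-|x|^2)^(-\<alpha>-1). *)
definition dirichlet_sol ::
    "(real^'n) measure \<Rightarrow> real \<Rightarrow> (real^'n \<Rightarrow> real) \<Rightarrow> real^'n \<Rightarrow> real" where
  "dirichlet_sol \<sigma> \<alpha> \<phi> x = (\<integral>\<zeta>. poisson_kernel \<alpha> x \<zeta> * \<phi> \<zeta> \<partial>\<sigma>)"

end

theory Submission
  imports Defs
begin

text \<open>
  Write n = CARD('n), u = P_\<alpha>[\<phi>] and \<delta> = 1 - |x|.  The proof has two halves, a local growth estimate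
    |u(x) - u(y)| \<le> C (\<omega>(\<delta>)/\<delta>) |x - y|   whenever |x - y| \<le> \<delta>/2,
  which rests on the monotonicity of \<omega>(t) and \<omega>(t)/t (dirichlet_sol_local_growth), and an
  integration of this estimate along radii in the style of Hardy and Littlewood, which is where \<omega>
  has to be fast (local_growth_imp_Lipschitz_space).

  For the first half, let \<eta> be the boundary point nearest to x, and split
    u(x) - u(y) = \<integral> (P(x,\<zeta>) - P(y,\<zeta>)) (\<phi>(\<zeta>) - \<phi>(\<eta>)) d\<sigma>(\<zeta>) + \<phi>(\<eta>) (U(x) - U(y)),   U = P_\<alpha>[1].
  In the integral, the kernel difference is O(\<delta>^\<alpha> |x-\<zeta>|^(-n-\<alpha>) |x-y|), while |\<zeta>-\<eta>| \<le> 2|x-\<zeta>| and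
  |x-\<zeta>| \<ge> \<delta> give |\<phi>(\<zeta>) - \<phi>(\<eta>)| = O(|x-\<zeta>| \<omega>(\<delta>)/\<delta>) because \<omega>(t)/t is non-increasing.  The
  integral is therefore under control once
    \<delta>^\<alpha> \<integral> |x-\<zeta>|^(-(n-1+\<alpha>)) d\<sigma>(\<zeta>)  is bounded.
  The constant function is in general not a solution of the equation, so U is not constant, and one
  also needs U to be Lipschitz; the derivative of the kernel alone is too singular to show this.

  Both facts come from one identity for the Riesz means J_q(x) = \<integral> |x-\<zeta>|^(-q) d\<sigma>(\<zeta>):
    (1-|x|^2)^b J_(n-1+b)(x) = J_(n-1-b)(x)   for every real b   (riesz_mean_kelvin).
  It turns the supercritical exponent n-1+\<alpha> into the subcritical n-1-\<alpha>, and it turns U into a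
  multiple of J_(n-2-\<alpha>), whose gradient is dominated by J_(n-1-\<alpha>).  Riesz means of exponent below
  n-1 are bounded (riesz_mean_bounded), and here \<alpha> > 0 is used.

  The measure \<sigma> is known only through its invariance, so no density is at hand.  Differentiating
  the invariance along rotations in coordinate planes gives the integration by parts formula
  integral_zonal_by_parts, and this replaces the density.  In hyperbolic polar coordinates it says
  that the means with exponents a and n-1-a solve the same radial eigenvalue equation of the
  hyperbolic Laplacian with the same initial data, so they coincide; this is the identity above.
  The boundedness of subcritical Riesz means is another consequence of the same formula.
\<close>

section \<open>Integration against the invariant measure on the sphere\<close>

locale rotation_invariant_sphere =
  fixes \<sigma> :: "(real^'n) measure"
  assumes dim: "CARD('n) \<ge> 2"
    and normalized: "normalized_sphere_measure \<sigma>"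
begin

lemma sets_sigma: "sets \<sigma> = sets (restrict_space borel (sphere 0 1))"
  using normalized by (simp add: normalized_sphere_measure_def)

lemma space_sigma [simp]: "space \<sigma> = sphere 0 1"
  using sets_eq_imp_space_eq[OF sets_sigma] by (simp add: space_restrict_space)

sublocale finite_measure \<sigma>
  using normalized by (intro finite_measureI) (simp add: normalized_sphere_measure_def)

lemma measure_sphere [simp]: "measure \<sigma> (sphere 0 1) = 1"
  using normalized by (simp add: normalized_sphere_measure_def measure_def)

lemma measurable_continuous [intro]:
  fixes f :: "real^'n \<Rightarrow> real"
  assumes "continuous_on (sphere 0 1) f"
  shows "f \<in> borel_measurable \<sigma>"
proof -
  have "f \<in> borel_measurable (restrict_space borel (sphere 0 1))"
    using assms by (rule borel_measurable_continuous_on_restrict)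
  then show ?thesis
    using measurable_cong_sets[OF sets_sigma refl] by blast
qed

lemma integrable_continuous [intro]:
  fixes f :: "real^'n \<Rightarrow> real"
  assumes "continuous_on (sphere 0 1) f"
  shows "integrable \<sigma> f"
proof -
  have "compact (f ` sphere 0 1)"
    using assms by (rule compact_continuous_image) simp
  then obtain B where "\<And>\<zeta>. \<zeta> \<in> sphere 0 1 \<Longrightarrow> norm (f \<zeta>) \<le> B"
    by (metis bounded_iff compact_imp_bounded imageI)
  then show ?thesis
    by (intro integrable_const_bound[of _ B]) (use assms in auto)
qed

lemma integral_rotation:
  fixes f :: "real^'n \<Rightarrow> real"
  assumes T: "orthogonal_transformation T" "det (matrix T) = 1"
    and f: "continuous_on (sphere 0 1) f"
  shows "(\<integral>\<zeta>. f (T \<zeta>) \<partial>\<sigma>) = (\<integral>\<zeta>. f \<zeta> \<partial>\<sigma>)"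
proof -
  have into: "T \<zeta> \<in> sphere 0 1" if "\<zeta> \<in> sphere 0 1" for \<zeta>
    using that orthogonal_transformation_norm[OF T(1)] by (simp add: dist_norm)
  have cont: "continuous_on S T" for S
    using T(1) linear_continuous_on linear_linear orthogonal_transformation_linear by blast
  have meas: "T \<in> measurable \<sigma> \<sigma>"
  proof -
    have "T \<in> measurable (restrict_space borel (sphere 0 1)) (restrict_space borel (sphere 0 1))"
      by (rule measurable_restrict_space3)
        (use cont into in \<open>auto intro!: borel_measurable_continuous_onI\<close>)
    then show ?thesis
      using measurable_cong_sets[OF sets_sigma sets_sigma] by blast
  qed
  have "distr \<sigma> \<sigma> T = \<sigma>"
  proof (rule measure_eqI)
    fix A assume "A \<in> sets (distr \<sigma> \<sigma> T)"
    then have A: "A \<in> sets \<sigma>" by simp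
    let ?B = "T -` A \<inter> space \<sigma>"
    have B: "?B \<in> sets \<sigma>" using meas A by (rule measurable_sets)
    have "T ` ?B = A"
    proof
      show "A \<subseteq> T ` ?B"
      proof
        fix a assume a: "a \<in> A"
        obtain z where z: "a = T z"
          using orthogonal_transformation_surj[OF T(1)] by (metis surjD)
        have "a \<in> sphere 0 1" using a sets.sets_into_space[OF A] by auto
        then have "z \<in> sphere 0 1"
          using orthogonal_transformation_norm[OF T(1)] z by (simp add: dist_norm)
        then show "a \<in> T ` ?B" using a z by auto
      qed
    qed auto
    moreover have "emeasure \<sigma> (T ` ?B) = emeasure \<sigma> ?B"
      using normalized T B unfolding normalized_sphere_measure_def by blast
    ultimately show "emeasure (distr \<sigma> \<sigma> T) A = emeasure \<sigma> A"
      using emeasure_distr[OF meas A] by simp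
  qed simp
  then show ?thesis
    using integral_distr[OF meas, of f] f by (metis measurable_continuous)
qed

text \<open>
  Differentiation under the integral sign: on a compact range of the parameter the derivative of
  the integrand is bounded, so difference quotients are dominated by a constant.
\<close>

lemma has_derivative_sphere_integral:
  fixes f f' :: "real \<Rightarrow> real^'n \<Rightarrow> real"
  assumes cont: "\<And>s. continuous_on (sphere 0 1) (f s)"
    and der: "\<And>s \<zeta>. \<zeta> \<in> sphere 0 1 \<Longrightarrow> ((\<lambda>s. f s \<zeta>) has_real_derivative f' s \<zeta>) (at s)"
    and cont': "continuous_on ({s0 - 1..s0 + 1} \<times> sphere 0 1) (\<lambda>(s, \<zeta>). f' s \<zeta>)"
  shows "((\<lambda>s. \<integral>\<zeta>. f s \<zeta> \<partial>\<sigma>) has_real_derivative (\<integral>\<zeta>. f' s0 \<zeta> \<partial>\<sigma>)) (at s0)"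
proof -
  have "compact ((\<lambda>(s, \<zeta>). f' s \<zeta>) ` ({s0 - 1..s0 + 1} \<times> sphere 0 1))"
    using cont' by (rule compact_continuous_image) (simp add: compact_Times)
  then obtain B where B': "\<And>p. p \<in> {s0 - 1..s0 + 1} \<times> sphere 0 1 \<Longrightarrow> norm ((\<lambda>(s, \<zeta>). f' s \<zeta>) p) \<le> B"
    by (metis bounded_iff compact_imp_bounded imageI)
  have B: "norm (f' s \<zeta>) \<le> B" if "s \<in> {s0 - 1..s0 + 1}" "\<zeta> \<in> sphere 0 1" for s \<zeta>
    using B'[of "(s, \<zeta>)"] that by simp
  have diff: "norm ((f s \<zeta> - f s0 \<zeta>) / (s - s0)) \<le> B"
    if "s \<in> {s0 - 1..s0 + 1}" "\<zeta> \<in> sphere 0 1" "s \<noteq> s0" for s \<zeta>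
  proof -
    have "norm (f s \<zeta> - f s0 \<zeta>) \<le> B * norm (s - s0)"
      by (rule field_differentiable_bound[of "{s0 - 1..s0 + 1}" _ "\<lambda>s. f' s \<zeta>"])
        (use that der B in \<open>auto intro: DERIV_subset[of _ _ _ UNIV]\<close>)
    then show ?thesis using that by (simp add: divide_simps)
  qed
  have meas': "f' s0 \<in> borel_measurable \<sigma>"
  proof (rule measurable_continuous)
    have "continuous_on (sphere 0 1) (\<lambda>\<zeta>. (\<lambda>(s, \<zeta>). f' s \<zeta>) (s0, \<zeta>))"
      by (rule continuous_on_compose2[OF cont']) (auto intro!: continuous_intros)
    then show "continuous_on (sphere 0 1) (f' s0)" by simp
  qed
  let ?F = "\<lambda>s. \<integral>\<zeta>. f s \<zeta> \<partial>\<sigma>"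
  show ?thesis
    unfolding has_field_derivative_iff tendsto_at_iff_sequentially
  proof (intro allI impI)
    fix X :: "nat \<Rightarrow> real"
    assume X: "\<forall>i. X i \<in> UNIV - {s0}" and lim: "X \<longlonglongrightarrow> s0"
    obtain N where N: "\<And>i. i \<ge> N \<Longrightarrow> dist (X i) s0 < 1"
      using lim unfolding lim_sequentially by (meson zero_less_one)
    have near: "X (i + N) \<in> {s0 - 1..s0 + 1}" for i
      using N[of "i + N"] by (auto simp: dist_real_def)
    have ne: "X i \<noteq> s0" for i using X by auto
    \<comment> \<open>The bound on the derivative holds only near s0, so the sequence enters the
      dominated convergence argument from the index N on.\<close>
    have limN: "(\<lambda>i. X (i + N)) \<longlonglongrightarrow> s0" using lim by (rule LIMSEQ_ignore_initial_segment)
    have "(\<lambda>i. \<integral>\<zeta>. (f (X (i + N)) \<zeta> - f s0 \<zeta>) / (X (i + N) - s0) \<partial>\<sigma>) \<longlonglongrightarrow> (\<integral>\<zeta>. f' s0 \<zeta> \<partial>\<sigma>)"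
    proof (rule integral_dominated_convergence[where w="\<lambda>_. B"])
      show "AE \<zeta> in \<sigma>. (\<lambda>i. (f (X (i + N)) \<zeta> - f s0 \<zeta>) / (X (i + N) - s0)) \<longlonglongrightarrow> f' s0 \<zeta>"
      proof (rule AE_I2)
        fix \<zeta> assume "\<zeta> \<in> space \<sigma>"
        then have "((\<lambda>s. (f s \<zeta> - f s0 \<zeta>) / (s - s0)) \<longlongrightarrow> f' s0 \<zeta>) (at s0)"
          using der unfolding has_field_derivative_iff by simp
        then show "(\<lambda>i. (f (X (i + N)) \<zeta> - f s0 \<zeta>) / (X (i + N) - s0)) \<longlonglongrightarrow> f' s0 \<zeta>"
          unfolding tendsto_at_iff_sequentially using limN ne
          by (auto simp: o_def)
      qed
      show "AE \<zeta> in \<sigma>. norm ((f (X (i + N)) \<zeta> - f s0 \<zeta>) / (X (i + N) - s0)) \<le> B" for i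
        using diff near ne by (intro AE_I2) simp
    qed (use cont meas' in \<open>auto intro!: measurable_continuous continuous_intros simp: ne\<close>)
    moreover have "(\<integral>\<zeta>. (f (X i) \<zeta> - f s0 \<zeta>) / (X i - s0) \<partial>\<sigma>) = (?F (X i) - ?F s0) / (X i - s0)" for i
      using cont by (simp add: Bochner_Integration.integral_diff integrable_continuous)
    ultimately have "(\<lambda>i. (?F (X (i + N)) - ?F s0) / (X (i + N) - s0)) \<longlonglongrightarrow> (\<integral>\<zeta>. f' s0 \<zeta> \<partial>\<sigma>)"
      by (simp only:)
    then show "((\<lambda>y. (?F y - ?F s0) / (y - s0)) \<circ> X) \<longlonglongrightarrow> (\<integral>\<zeta>. f' s0 \<zeta> \<partial>\<sigma>)"
      unfolding o_def by (rule LIMSEQ_offset)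
  qed
qed

end

definition plane_rotation :: "'n \<Rightarrow> 'n \<Rightarrow> real \<Rightarrow> real^'n \<Rightarrow> real^'n" where
  "plane_rotation k j \<theta> x =
     (\<chi> i. if i = k then cos \<theta> * x$k - sin \<theta> * x$j
          else if i = j then sin \<theta> * x$k + cos \<theta> * x$j else x$i)"

lemma orthogonal_plane_rotation:
  assumes "k \<noteq> j"
  shows "orthogonal_transformation (plane_rotation k j \<theta> :: real^'n \<Rightarrow> _)"
proof -
  have "plane_rotation k j \<theta> v \<bullet> plane_rotation k j \<theta> w = v \<bullet> w" for v w :: "real^'n"
  proof -
    have split: "a \<bullet> b = a$k * b$k + a$j * b$j + (\<Sum>i\<in>UNIV - {k, j}. a$i * b$i)" for a b :: "real^'n"
    proof -
      have "a \<bullet> b = (\<Sum>i\<in>{k, j}. a$i * b$i) + (\<Sum>i\<in>UNIV - {k, j}. a$i * b$i)"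
        unfolding inner_vec_def inner_real_def
        by (subst sum.subset_diff[of "{k, j}"]) (auto simp: add.commute)
      then show ?thesis using assms by simp
    qed
    have rest: "(\<Sum>i\<in>UNIV - {k, j}. plane_rotation k j \<theta> v $ i * plane_rotation k j \<theta> w $ i)
        = (\<Sum>i\<in>UNIV - {k, j}. v$i * w$i)"
      by (rule sum.cong) (auto simp: plane_rotation_def)
    have "(cos \<theta> * v$k - sin \<theta> * v$j) * (cos \<theta> * w$k - sin \<theta> * w$j)
        + (sin \<theta> * v$k + cos \<theta> * v$j) * (sin \<theta> * w$k + cos \<theta> * w$j)
        = ((sin \<theta>)\<^sup>2 + (cos \<theta>)\<^sup>2) * (v$k * w$k + v$j * w$j)"
      by algebra
    then have "(cos \<theta> * v$k - sin \<theta> * v$j) * (cos \<theta> * w$k - sin \<theta> * w$j)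
        + (sin \<theta> * v$k + cos \<theta> * v$j) * (sin \<theta> * w$k + cos \<theta> * w$j) = v$k * w$k + v$j * w$j"
      by (simp only: sin_cos_squared_add mult_1)
    then show ?thesis
      unfolding split rest using assms by (simp add: plane_rotation_def)
  qed
  moreover have "linear (plane_rotation k j \<theta> :: real^'n \<Rightarrow> _)"
    by (intro linearI) (auto simp: plane_rotation_def vec_eq_iff algebra_simps)
  ultimately show ?thesis by (simp add: orthogonal_transformation_def)
qed

text \<open>
  The determinant of an orthogonal matrix is a sign, and a rotation is the square of the rotation
  by half the angle.
\<close>

lemma det_plane_rotation:
  assumes "k \<noteq> j"
  shows "det (matrix (plane_rotation k j \<theta> :: real^'n \<Rightarrow> _)) = 1"
proof -
  let ?R = "plane_rotation k j :: real \<Rightarrow> real^'n \<Rightarrow> _"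
  let ?M = "matrix (?R (\<theta>/2))"
  have c: "cos \<theta> = cos (\<theta>/2) * cos (\<theta>/2) - sin (\<theta>/2) * sin (\<theta>/2)"
    and s: "sin \<theta> = sin (\<theta>/2) * cos (\<theta>/2) + cos (\<theta>/2) * sin (\<theta>/2)"
    using cos_add[of "\<theta>/2" "\<theta>/2"] sin_add[of "\<theta>/2" "\<theta>/2"] by simp_all
  have comp: "?R \<theta> = ?R (\<theta>/2) \<circ> ?R (\<theta>/2)"
    using assms by (intro ext) (auto simp: plane_rotation_def vec_eq_iff c s algebra_simps)
  have lin: "linear (?R (\<theta>/2))" "orthogonal_matrix ?M"
    using orthogonal_plane_rotation[OF assms]
    by (auto simp: orthogonal_transformation_matrix)
  have "matrix (?R \<theta>) = ?M ** ?M"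
    unfolding comp using lin by (intro matrix_compose)
  then have "det (matrix (?R \<theta>)) = det ?M * det ?M" by (simp add: det_mul)
  then show ?thesis using det_orthogonal_matrix[OF lin(2)] by auto
qed

section \<open>Integration by parts for zonal functions\<close>

context rotation_invariant_sphere
begin

text \<open>
  The integral of \<zeta>_j h(\<zeta>_k) does not change when \<zeta> is rotated in the plane of the axes k and j.
  The formula is the derivative of this invariance at angle zero.
\<close>

lemma integral_coordinate_by_parts:
  fixes h h' :: "real \<Rightarrow> real" and k j :: 'n
  assumes kj: "k \<noteq> j"
    and der: "\<And>t. t \<in> {-1..1} \<Longrightarrow> (h has_real_derivative h' t) (at t)"
    and h': "continuous_on {-1..1} h'"
  shows "(\<integral>\<zeta>. \<zeta>$k * h (\<zeta>$k) - (\<zeta>$j)\<^sup>2 * h' (\<zeta>$k) \<partial>\<sigma>) = 0"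
proof -
  let ?R = "plane_rotation k j :: real \<Rightarrow> real^'n \<Rightarrow> _"
  let ?g = "\<lambda>\<zeta>::real^'n. \<zeta>$j * h (\<zeta>$k)"
  let ?f' = "\<lambda>\<theta> \<zeta>. ?R \<theta> \<zeta> $ k * h (?R \<theta> \<zeta> $ k) - (?R \<theta> \<zeta> $ j)\<^sup>2 * h' (?R \<theta> \<zeta> $ k)"
  have Rk: "?R \<theta> \<zeta> $ k = cos \<theta> * \<zeta>$k - sin \<theta> * \<zeta>$j"
    and Rj: "?R \<theta> \<zeta> $ j = sin \<theta> * \<zeta>$k + cos \<theta> * \<zeta>$j" for \<theta> \<zeta>
    using kj by (auto simp: plane_rotation_def)
  have bnd: "\<zeta>$i \<in> {-1..1}" if "\<zeta> \<in> sphere 0 1" for \<zeta> :: "real^'n" and i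
    using component_le_norm_cart[of \<zeta> i] that by (auto simp: dist_norm)
  have into: "?R \<theta> \<zeta> \<in> sphere 0 1" if "\<zeta> \<in> sphere 0 1" for \<theta> \<zeta>
    using that orthogonal_transformation_norm[OF orthogonal_plane_rotation[OF kj]] by (simp add: dist_norm)
  have h: "continuous_on {-1..1} h"
    using der by (meson DERIV_atLeastAtMost_imp_continuous_on atLeastAtMost_iff)
  have contR: "continuous_on S (\<lambda>p. ?R (fst p) (snd p) $ k)"
      "continuous_on S (\<lambda>p. ?R (fst p) (snd p) $ j)" for S
    unfolding Rk Rj by (intro continuous_intros)+
  have g: "continuous_on (sphere 0 1) ?g"
    by (intro continuous_intros continuous_on_compose2[OF h]) (use bnd in auto)
  have fcont: "continuous_on (sphere 0 1) (\<lambda>\<zeta>. ?g (?R \<theta> \<zeta>))" for \<theta>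
  proof (rule continuous_on_compose2[OF g])
    show "continuous_on (sphere 0 1) (?R \<theta>)"
      using orthogonal_plane_rotation[OF kj] linear_continuous_on linear_linear
        orthogonal_transformation_linear by blast
  qed (use into in auto)
  have "((\<lambda>\<theta>. \<integral>\<zeta>. ?g (?R \<theta> \<zeta>) \<partial>\<sigma>) has_real_derivative (\<integral>\<zeta>. ?f' 0 \<zeta> \<partial>\<sigma>)) (at 0)"
  proof (rule has_derivative_sphere_integral)
    show "continuous_on (sphere 0 1) (\<lambda>\<zeta>. ?g (?R \<theta> \<zeta>))" for \<theta> by (rule fcont)
    show "((\<lambda>\<theta>. ?g (?R \<theta> \<zeta>)) has_real_derivative ?f' \<theta> \<zeta>) (at \<theta>)" if z: "\<zeta> \<in> sphere 0 1" for \<theta> \<zeta>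
    proof -
      have dk: "((\<lambda>\<theta>. ?R \<theta> \<zeta> $ k) has_real_derivative - (?R \<theta> \<zeta> $ j)) (at \<theta>)"
        unfolding Rk Rj by (auto intro!: derivative_eq_intros)
      have dj: "((\<lambda>\<theta>. ?R \<theta> \<zeta> $ j) has_real_derivative ?R \<theta> \<zeta> $ k) (at \<theta>)"
        unfolding Rk Rj by (auto intro!: derivative_eq_intros)
      have "((\<lambda>\<theta>. h (?R \<theta> \<zeta> $ k)) has_real_derivative h' (?R \<theta> \<zeta> $ k) * - (?R \<theta> \<zeta> $ j)) (at \<theta>)"
        using DERIV_chain2[OF der dk] bnd[OF into[OF z]] by blast
      from DERIV_mult[OF dj this] show ?thesis
        by (simp add: power2_eq_square algebra_simps)
    qed
    show "continuous_on ({0 - 1..0 + 1} \<times> sphere 0 1) (\<lambda>(\<theta>, \<zeta>). ?f' \<theta> \<zeta>)"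
      unfolding case_prod_unfold
      by (intro continuous_intros contR continuous_on_compose2[OF h] continuous_on_compose2[OF h'])
        (use into bnd in \<open>force+\<close>)
  qed
  moreover have "(\<integral>\<zeta>. ?g (?R \<theta> \<zeta>) \<partial>\<sigma>) = (\<integral>\<zeta>. ?g \<zeta> \<partial>\<sigma>)" for \<theta>
    using integral_rotation[OF orthogonal_plane_rotation[OF kj] det_plane_rotation[OF kj] g] .
  ultimately have "((\<lambda>\<theta>. \<integral>\<zeta>. ?g \<zeta> \<partial>\<sigma>) has_real_derivative (\<integral>\<zeta>. ?f' 0 \<zeta> \<partial>\<sigma>)) (at (0::real))"
    by simp
  then have "(\<integral>\<zeta>. ?f' 0 \<zeta> \<partial>\<sigma>) = 0"
    using DERIV_const DERIV_unique by blast
  moreover have "?R 0 \<zeta> = \<zeta>" for \<zeta>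
    using kj by (simp add: plane_rotation_def vec_eq_iff)
  ultimately show ?thesis by simp
qed

text \<open>
  The law of e \<bullet> \<zeta> does not depend on the unit vector e, since a rotation takes any axis to e.  This
  is the transitivity of the rotation group on the sphere, where n \<ge> 2 enters.
\<close>

lemma integral_inner_eq_integral_coordinate:
  fixes e :: "real^'n" and k :: 'n
  assumes e: "norm e = 1" and g: "continuous_on {-1..1} (g :: real \<Rightarrow> real)"
  shows "(\<integral>\<zeta>. g (e \<bullet> \<zeta>) \<partial>\<sigma>) = (\<integral>\<zeta>. g (\<zeta>$k) \<partial>\<sigma>)"
proof -
  obtain T where T: "orthogonal_transformation T" "det (matrix T) = 1" "T (axis k 1) = e"
    using rotation_exists[of "axis k (1::real)" e] dim e by (auto simp: norm_axis_1)
  have bnd: "e \<bullet> \<zeta> \<in> {-1..1}" if "\<zeta> \<in> sphere 0 1" for \<zeta>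
    using Cauchy_Schwarz_ineq2[of e \<zeta>] that e by (auto simp: dist_norm)
  have "(\<integral>\<zeta>. g (e \<bullet> \<zeta>) \<partial>\<sigma>) = (\<integral>\<zeta>. g (e \<bullet> T \<zeta>) \<partial>\<sigma>)"
    by (rule integral_rotation[OF T(1,2), of "\<lambda>\<zeta>. g (e \<bullet> \<zeta>)", symmetric])
      (intro continuous_intros continuous_on_compose2[OF g], use bnd in auto)
  moreover have "e \<bullet> T \<zeta> = \<zeta>$k" for \<zeta>
    using T(1) unfolding T(3)[symmetric] by (simp add: orthogonal_transformation_def inner_axis')
  ultimately show ?thesis by simp
qed

text \<open>
  This is the sum of the coordinate formulas over the n-1 axes orthogonal to e, with
  \<Sum> \<zeta>_j^2 = 1 - (e \<bullet> \<zeta>)^2.  It says that the law of t = e \<bullet> \<zeta> satisfies, in the weak sense, the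
  differential equation of the density (1-t^2)^((n-3)/2), and it serves in place of that density.
\<close>

lemma integral_zonal_by_parts:
  fixes h h' :: "real \<Rightarrow> real" and e :: "real^'n"
  assumes e: "norm e = 1"
    and der: "\<And>t. t \<in> {-1..1} \<Longrightarrow> (h has_real_derivative h' t) (at t)"
    and h': "continuous_on {-1..1} h'"
  shows "(\<integral>\<zeta>. (real CARD('n) - 1) * ((e \<bullet> \<zeta>) * h (e \<bullet> \<zeta>)) \<partial>\<sigma>)
       = (\<integral>\<zeta>. (1 - (e \<bullet> \<zeta>)\<^sup>2) * h' (e \<bullet> \<zeta>) \<partial>\<sigma>)"
proof -
  obtain k :: 'n where True by blast
  let ?m = "real CARD('n) - 1"
  have h: "continuous_on {-1..1} h"
    using der by (meson DERIV_atLeastAtMost_imp_continuous_on atLeastAtMost_iff)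
  have bnd: "\<zeta>$i \<in> {-1..1}" if "\<zeta> \<in> sphere 0 1" for \<zeta> :: "real^'n" and i
    using component_le_norm_cart[of \<zeta> i] that by (auto simp: dist_norm)
  have cont: "continuous_on (sphere 0 1) (\<lambda>\<zeta>::real^'n. \<zeta>$k * h (\<zeta>$k))"
      "continuous_on (sphere 0 1) (\<lambda>\<zeta>::real^'n. h' (\<zeta>$k))"
    by (intro continuous_intros continuous_on_compose2[OF h] continuous_on_compose2[OF h'];
        use bnd in auto)+
  have int: "integrable \<sigma> (\<lambda>\<zeta>. \<zeta>$k * h (\<zeta>$k))" "integrable \<sigma> (\<lambda>\<zeta>. (\<zeta>$j)\<^sup>2 * h' (\<zeta>$k))" for j
    using cont by (auto intro!: integrable_continuous continuous_intros)
  have "(\<integral>\<zeta>. (1 - (\<zeta>$k)\<^sup>2) * h' (\<zeta>$k) \<partial>\<sigma>) = (\<integral>\<zeta>. (\<Sum>j\<in>UNIV - {k}. (\<zeta>$j)\<^sup>2 * h' (\<zeta>$k)) \<partial>\<sigma>)"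
  proof (rule Bochner_Integration.integral_cong)
    fix \<zeta> :: "real^'n" assume "\<zeta> \<in> space \<sigma>"
    then have "(\<Sum>j\<in>UNIV. (\<zeta>$j)\<^sup>2) = 1"
      by (simp add: norm_vec_def L2_set_def dist_norm)
    then have "(\<Sum>j\<in>UNIV - {k}. (\<zeta>$j)\<^sup>2) = 1 - (\<zeta>$k)\<^sup>2"
      by (simp add: sum.remove[of UNIV k])
    then show "(1 - (\<zeta>$k)\<^sup>2) * h' (\<zeta>$k) = (\<Sum>j\<in>UNIV - {k}. (\<zeta>$j)\<^sup>2 * h' (\<zeta>$k))"
      by (metis sum_distrib_right)
  qed simp
  also have "\<dots> = (\<Sum>j\<in>UNIV - {k}. \<integral>\<zeta>. (\<zeta>$j)\<^sup>2 * h' (\<zeta>$k) \<partial>\<sigma>)"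
    using int by (intro Bochner_Integration.integral_sum) auto
  also have "\<dots> = (\<Sum>j\<in>UNIV - {k}. \<integral>\<zeta>. \<zeta>$k * h (\<zeta>$k) \<partial>\<sigma>)"
  proof (rule sum.cong)
    fix j assume "j \<in> UNIV - {k}"
    then have kj: "k \<noteq> j" by auto
    show "(\<integral>\<zeta>. (\<zeta>$j)\<^sup>2 * h' (\<zeta>$k) \<partial>\<sigma>) = (\<integral>\<zeta>. \<zeta>$k * h (\<zeta>$k) \<partial>\<sigma>)"
      using integral_coordinate_by_parts[OF kj der h']
        Bochner_Integration.integral_diff[OF int(1) int(2)[of j]] by simp
  qed simp
  also have "\<dots> = ?m * (\<integral>\<zeta>. \<zeta>$k * h (\<zeta>$k) \<partial>\<sigma>)"
    by (simp add: card_Diff_singleton of_nat_diff)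
  also have "\<dots> = (\<integral>\<zeta>. ?m * (\<zeta>$k * h (\<zeta>$k)) \<partial>\<sigma>)" by simp
  finally have "(\<integral>\<zeta>. ?m * (\<zeta>$k * h (\<zeta>$k)) \<partial>\<sigma>) = (\<integral>\<zeta>. (1 - (\<zeta>$k)\<^sup>2) * h' (\<zeta>$k) \<partial>\<sigma>)" by simp
  moreover have "(\<integral>\<zeta>. ?m * ((e \<bullet> \<zeta>) * h (e \<bullet> \<zeta>)) \<partial>\<sigma>) = (\<integral>\<zeta>. ?m * (\<zeta>$k * h (\<zeta>$k)) \<partial>\<sigma>)"
    by (rule integral_inner_eq_integral_coordinate[OF e, where g="\<lambda>t. ?m * (t * h t)"])
      (intro continuous_intros h)
  moreover have "(\<integral>\<zeta>. (1 - (e \<bullet> \<zeta>)\<^sup>2) * h' (e \<bullet> \<zeta>) \<partial>\<sigma>) = (\<integral>\<zeta>. (1 - (\<zeta>$k)\<^sup>2) * h' (\<zeta>$k) \<partial>\<sigma>)"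
    by (rule integral_inner_eq_integral_coordinate[OF e, where g="\<lambda>t. (1 - t\<^sup>2) * h' t"])
      (intro continuous_intros h')
  ultimately show ?thesis by simp
qed

end

section \<open>Hyperbolic means and their symmetry\<close>

text \<open>
  The coefficient m coth s is singular at 0, but it damps: in the derivative of the energy
  f^2 + f'^2 it contributes -2 m coth(s) f'^2 \<le> 0, so a Gronwall argument runs through from the
  singular point.  The equation itself forces f'(0) = 0.
\<close>

lemma radial_ode_unique:
  fixes f f\<^sub>1 f\<^sub>2 :: "real \<Rightarrow> real"
  assumes f: "\<And>s. (f has_real_derivative f\<^sub>1 s) (at s)"
    and f\<^sub>1: "\<And>s. (f\<^sub>1 has_real_derivative f\<^sub>2 s) (at s)"
    and ode: "\<And>s. sinh s * f\<^sub>2 s + m * cosh s * f\<^sub>1 s + c * sinh s * f s = 0"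
    and m: "m > 0" and f0: "f 0 = 0" and s: "s \<ge> 0"
  shows "f s = 0"
proof -
  have f\<^sub>1_0: "f\<^sub>1 0 = 0" using ode[of 0] m by simp
  define C where "C = \<bar>1 - c\<bar>"
  define E where "E = (\<lambda>s. (f s)\<^sup>2 + (f\<^sub>1 s)\<^sup>2)"
  define E' where "E' = (\<lambda>s. 2 * f s * f\<^sub>1 s + 2 * f\<^sub>1 s * f\<^sub>2 s)"
  have E: "(E has_real_derivative E' s) (at s)" for s
    unfolding E_def E'_def by (auto intro!: derivative_eq_intros f f\<^sub>1)
  have E'_le: "E' s \<le> C * E s" if "s \<ge> 0" for s
  proof (cases "s = 0")
    case True
    then show ?thesis by (simp add: E'_def E_def f\<^sub>1_0 f0)
  next
    case False
    then have sh: "sinh s > 0" using that by simp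
    have "sinh s * E' s = 2 * f\<^sub>1 s * (sinh s * f s + sinh s * f\<^sub>2 s)"
      by (simp add: E'_def algebra_simps)
    also have "\<dots> = 2 * f\<^sub>1 s * (sinh s * f s - m * cosh s * f\<^sub>1 s - c * sinh s * f s)"
    proof -
      have "sinh s * f\<^sub>2 s = - m * cosh s * f\<^sub>1 s - c * sinh s * f s" using ode[of s] by linarith
      then show ?thesis by simp
    qed
    also have "\<dots> = sinh s * ((1 - c) * (2 * f s * f\<^sub>1 s)) - 2 * m * cosh s * (f\<^sub>1 s)\<^sup>2"
      by (simp add: algebra_simps power2_eq_square)
    also have "\<dots> \<le> sinh s * ((1 - c) * (2 * f s * f\<^sub>1 s))"
      using m by simp
    finally have "E' s \<le> (1 - c) * (2 * f s * f\<^sub>1 s)" using sh by simp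
    also have "\<dots> \<le> \<bar>1 - c\<bar> * \<bar>2 * f s * f\<^sub>1 s\<bar>"
      by (metis abs_ge_self abs_mult)
    also have "\<dots> \<le> C * E s"
      unfolding C_def E_def
    proof (rule mult_left_mono)
      show "\<bar>2 * f s * f\<^sub>1 s\<bar> \<le> (f s)\<^sup>2 + (f\<^sub>1 s)\<^sup>2"
        using sum_squares_bound[of "f s" "f\<^sub>1 s"] sum_squares_bound[of "- f s" "f\<^sub>1 s"] by simp
    qed simp
    finally show ?thesis .
  qed
  have "E s * exp (- C * s) \<le> E 0 * exp (- C * 0)"
  proof (rule DERIV_nonpos_imp_nonincreasing[OF s])
    fix x :: real assume x: "0 \<le> x" "x \<le> s"
    have "((\<lambda>s. E s * exp (- C * s)) has_real_derivative (E' x - C * E x) * exp (- C * x)) (at x)"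
      by (auto intro!: derivative_eq_intros E simp: algebra_simps)
    moreover have "(E' x - C * E x) * exp (- C * x) \<le> 0"
      using E'_le[OF x(1)] by (simp add: mult_le_0_iff)
    ultimately show "\<exists>y. ((\<lambda>s. E s * exp (- C * s)) has_real_derivative y) (at x) \<and> y \<le> 0" by blast
  qed
  then have "E s \<le> 0" by (simp add: E_def f0 f\<^sub>1_0 mult_le_0_iff)
  then show ?thesis
    by (simp add: E_def sum_power2_le_zero_iff)
qed

lemma cosh_minus_inner_sinh_pos:
  fixes t s :: real
  assumes "t \<in> {-1..1}"
  shows "cosh s - t * sinh s > 0"
proof -
  have "\<bar>t * sinh s\<bar> \<le> 1 * \<bar>sinh s\<bar>"
    unfolding abs_mult using assms by (intro mult_right_mono) auto
  also have "\<dots> < cosh s"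
    using sinh_less_cosh_real[of s] sinh_less_cosh_real[of "-s"] by auto
  finally show ?thesis by linarith
qed

context rotation_invariant_sphere
begin

text \<open>
  As functions of s these are the spherical functions of hyperbolic n-space, where s is the distance
  from the origin and -a(n-1-a) is the eigenvalue of the Laplacian.
\<close>

definition hyperbolic_mean :: "real^'n \<Rightarrow> real \<Rightarrow> real \<Rightarrow> real" where
  "hyperbolic_mean e a s = (\<integral>\<zeta>. (cosh s - (e \<bullet> \<zeta>) * sinh s) powr (- a) \<partial>\<sigma>)"

text \<open>
  With y = cosh s - t sinh s and y' = sinh s - t cosh s one has y'' = y and y'^2 = y^2 - (1 - t^2), so
  the second derivative of y^(-a) is a^2 y^(-a) - a(a+1)(1-t^2) y^(-a-2).  Integration by parts with
  h(t) = y^(-a-1) removes the factor 1-t^2, and the outcome is the radial equation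
  K'' + (n-1) coth(s) K' + a(n-1-a) K = 0.
\<close>

lemma hyperbolic_mean_ode:
  assumes e: "norm e = 1"
  obtains f\<^sub>1 f\<^sub>2 where
    "\<And>s. (hyperbolic_mean e a has_real_derivative f\<^sub>1 s) (at s)"
    "\<And>s. (f\<^sub>1 has_real_derivative f\<^sub>2 s) (at s)"
    "\<And>s. sinh s * f\<^sub>2 s + (real CARD('n) - 1) * cosh s * f\<^sub>1 s
          + a * (real CARD('n) - 1 - a) * sinh s * hyperbolic_mean e a s = 0"
proof
  let ?m = "real CARD('n) - 1"
  define y where "y = (\<lambda>s (\<zeta>::real^'n). cosh s - (e \<bullet> \<zeta>) * sinh s)"
  define y' where "y' = (\<lambda>s (\<zeta>::real^'n). sinh s - (e \<bullet> \<zeta>) * cosh s)"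
  define g\<^sub>1 where "g\<^sub>1 = (\<lambda>s \<zeta>. - a * (y' s \<zeta> * y s \<zeta> powr (- a - 1)))"
  define g\<^sub>2 where "g\<^sub>2 = (\<lambda>s \<zeta>. a\<^sup>2 * y s \<zeta> powr (- a) - a * (a + 1) * ((1 - (e \<bullet> \<zeta>)\<^sup>2) * y s \<zeta> powr (- a - 2)))"
  have bnd: "e \<bullet> \<zeta> \<in> {-1..1}" if "\<zeta> \<in> sphere 0 1" for \<zeta>
    using Cauchy_Schwarz_ineq2[of e \<zeta>] that e by (auto simp: dist_norm)
  have ypos: "y s \<zeta> > 0" if "\<zeta> \<in> sphere 0 1" for s \<zeta>
    unfolding y_def using cosh_minus_inner_sinh_pos[OF bnd[OF that]] .
  have dy: "((\<lambda>s. y s \<zeta>) has_real_derivative y' s \<zeta>) (at s)"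
    and dy': "((\<lambda>s. y' s \<zeta>) has_real_derivative y s \<zeta>) (at s)" for s \<zeta>
    unfolding y_def y'_def by (auto intro!: derivative_eq_intros)
  have dp: "((\<lambda>s. y s \<zeta> powr b) has_real_derivative b * (y' s \<zeta> * y s \<zeta> powr (b - 1))) (at s)"
    if "\<zeta> \<in> sphere 0 1" for s \<zeta> b
    using DERIV_fun_powr[OF dy ypos[OF that], of b s] by (simp add: mult_ac)
  have cy: "continuous_on (A \<times> sphere 0 1) (\<lambda>p. y (fst p) (snd p))"
       "continuous_on (A \<times> sphere 0 1) (\<lambda>p. y' (fst p) (snd p))" for A
    unfolding y_def y'_def by (intro continuous_intros)+
  have cpow: "continuous_on (A \<times> sphere 0 1) (\<lambda>p. y (fst p) (snd p) powr b)" for A b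
  proof (rule continuous_on_powr[OF cy(1) continuous_on_const], rule ballI)
    fix p :: "real \<times> (real^'n)" assume "p \<in> A \<times> sphere 0 1"
    then show "y (fst p) (snd p) \<noteq> 0" using ypos[of "snd p" "fst p"] by auto
  qed
  have c1: "continuous_on (A \<times> sphere 0 1) (\<lambda>(s, \<zeta>). g\<^sub>1 s \<zeta>)"
    and c2: "continuous_on (A \<times> sphere 0 1) (\<lambda>(s, \<zeta>). g\<^sub>2 s \<zeta>)" for A
    unfolding g\<^sub>1_def g\<^sub>2_def case_prod_unfold by (intro continuous_intros cy cpow)+
  have slice: "continuous_on (sphere 0 1) (g s)"
    if "continuous_on (UNIV \<times> sphere 0 1) (\<lambda>(s, \<zeta>). g s \<zeta>)" for g :: "real \<Rightarrow> real^'n \<Rightarrow> real" and s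
  proof -
    have "continuous_on (sphere 0 1) (\<lambda>\<zeta>. (\<lambda>(s, \<zeta>). g s \<zeta>) (s, \<zeta>))"
      by (rule continuous_on_compose2[OF that]) (auto intro!: continuous_intros)
    then show ?thesis by simp
  qed
  have cpow1: "continuous_on (sphere 0 1) (\<lambda>\<zeta>. y s \<zeta> powr b)" for s b
    using slice[of "\<lambda>s \<zeta>. y s \<zeta> powr b"] cpow by (simp add: case_prod_unfold)
  have hm: "hyperbolic_mean e a = (\<lambda>s. \<integral>\<zeta>. y s \<zeta> powr (- a) \<partial>\<sigma>)"
    by (rule ext) (simp add: hyperbolic_mean_def y_def)
  show "(hyperbolic_mean e a has_real_derivative (\<integral>\<zeta>. g\<^sub>1 s \<zeta> \<partial>\<sigma>)) (at s)" for s
    unfolding hm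
  proof (rule has_derivative_sphere_integral[OF cpow1 _ c1])
    show "((\<lambda>s. y s \<zeta> powr - a) has_real_derivative g\<^sub>1 s \<zeta>) (at s)" if "\<zeta> \<in> sphere 0 1" for s \<zeta>
      using dp[OF that, of "- a" s] by (simp add: g\<^sub>1_def)
  qed
  show "((\<lambda>s. \<integral>\<zeta>. g\<^sub>1 s \<zeta> \<partial>\<sigma>) has_real_derivative (\<integral>\<zeta>. g\<^sub>2 s \<zeta> \<partial>\<sigma>)) (at s)" for s
  proof (rule has_derivative_sphere_integral[OF slice[OF c1] _ c2])
    fix s and \<zeta> :: "real^'n" assume z: "\<zeta> \<in> sphere 0 1"
    let ?Y = "y s \<zeta>" and ?Y' = "y' s \<zeta>" and ?t = "e \<bullet> \<zeta>"
    have p1: "?Y powr (- a) = ?Y\<^sup>2 * ?Y powr (- a - 2)"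
      using ypos[OF z, of s] powr_add[of ?Y 2 "- a - 2"] by simp
    have p2: "?Y * ?Y powr (- a - 1) = ?Y powr (- a)"
      using ypos[OF z, of s] powr_add[of ?Y 1 "- a - 1"] by simp
    have sq: "?Y'\<^sup>2 = ?Y\<^sup>2 - (1 - ?t\<^sup>2)"
    proof -
      have "(cosh s)\<^sup>2 = (sinh s)\<^sup>2 + 1" by (rule cosh_square_eq)
      then show ?thesis unfolding y_def y'_def by algebra
    qed
    have "((\<lambda>s. g\<^sub>1 s \<zeta>) has_real_derivative
        - a * (?Y * ?Y powr (- a - 1) + ((- a - 1) * (?Y' * ?Y powr (- a - 1 - 1))) * ?Y')) (at s)"
      unfolding g\<^sub>1_def by (intro DERIV_cmult DERIV_mult dy' dp z)
    moreover have "- a * (?Y * ?Y powr (- a - 1) + ((- a - 1) * (?Y' * ?Y powr (- a - 1 - 1))) * ?Y')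
       = - a * ?Y powr (- a) + a * (a + 1) * (?Y'\<^sup>2 * ?Y powr (- a - 2))"
      unfolding p2[symmetric] by (simp add: algebra_simps power2_eq_square)
    moreover have "\<dots> = g\<^sub>2 s \<zeta>"
      unfolding g\<^sub>2_def sq p1 by (simp add: algebra_simps power2_eq_square)
    ultimately show "((\<lambda>s. g\<^sub>1 s \<zeta>) has_real_derivative g\<^sub>2 s \<zeta>) (at s)" by simp
  qed
  fix s :: real
  let ?A = "\<integral>\<zeta>. (e \<bullet> \<zeta>) * y s \<zeta> powr (- a - 1) \<partial>\<sigma>"
  let ?B = "\<integral>\<zeta>. (1 - (e \<bullet> \<zeta>)\<^sup>2) * y s \<zeta> powr (- a - 2) \<partial>\<sigma>"
  let ?K = "hyperbolic_mean e a s"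
  have int: "integrable \<sigma> (\<lambda>\<zeta>. y s \<zeta> powr b)"
      "integrable \<sigma> (\<lambda>\<zeta>. (e \<bullet> \<zeta>) * y s \<zeta> powr b)"
      "integrable \<sigma> (\<lambda>\<zeta>. (1 - (e \<bullet> \<zeta>)\<^sup>2) * y s \<zeta> powr b)"
      "integrable \<sigma> (g\<^sub>1 s)" for b
    by (intro integrable_continuous continuous_intros cpow1 slice[OF c1])+
  have parts: "?m * ?A = (a + 1) * sinh s * ?B"
  proof -
    have "(\<integral>\<zeta>. ?m * ((e \<bullet> \<zeta>) * (cosh s - (e \<bullet> \<zeta>) * sinh s) powr (- a - 1)) \<partial>\<sigma>)
       = (\<integral>\<zeta>. (1 - (e \<bullet> \<zeta>)\<^sup>2) * ((a + 1) * sinh s * (cosh s - (e \<bullet> \<zeta>) * sinh s) powr (- a - 2)) \<partial>\<sigma>)"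
    proof (rule integral_zonal_by_parts[OF e])
      fix t :: real assume t: "t \<in> {-1..1}"
      have d: "((\<lambda>t. cosh s - t * sinh s) has_real_derivative - sinh s) (at t)"
        by (auto intro!: derivative_eq_intros)
      show "((\<lambda>t. (cosh s - t * sinh s) powr (- a - 1)) has_real_derivative
          (a + 1) * sinh s * (cosh s - t * sinh s) powr (- a - 2)) (at t)"
        using DERIV_fun_powr[OF d cosh_minus_inner_sinh_pos[OF t], of "- a - 1"]
        by (simp add: algebra_simps)
    next
      show "continuous_on {-1..1} (\<lambda>t. (a + 1) * sinh s * (cosh s - t * sinh s) powr (- a - 2))"
        using cosh_minus_inner_sinh_pos[of _ s] by (intro continuous_intros) force
    qed
    moreover have "(\<integral>\<zeta>. (1 - (e \<bullet> \<zeta>)\<^sup>2) * ((a + 1) * sinh s * (cosh s - (e \<bullet> \<zeta>) * sinh s) powr (- a - 2)) \<partial>\<sigma>)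
        = (\<integral>\<zeta>. (a + 1) * sinh s * ((1 - (e \<bullet> \<zeta>)\<^sup>2) * y s \<zeta> powr (- a - 2)) \<partial>\<sigma>)"
      unfolding y_def by (simp add: mult_ac)
    ultimately show ?thesis by (simp add: y_def)
  qed
  have K2: "(\<integral>\<zeta>. g\<^sub>2 s \<zeta> \<partial>\<sigma>) = a\<^sup>2 * ?K - a * (a + 1) * ?B"
    unfolding g\<^sub>2_def hm
    by (subst Bochner_Integration.integral_diff) (use int in auto)
  have K1: "cosh s * (\<integral>\<zeta>. g\<^sub>1 s \<zeta> \<partial>\<sigma>) + a * sinh s * ?K = a * ?A"
  proof -
    have "cosh s * (\<integral>\<zeta>. g\<^sub>1 s \<zeta> \<partial>\<sigma>) + a * sinh s * ?K
        = (\<integral>\<zeta>. cosh s * g\<^sub>1 s \<zeta> + a * sinh s * y s \<zeta> powr (- a) \<partial>\<sigma>)"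
      unfolding hm by (subst Bochner_Integration.integral_add) (use int in auto)
    also have "\<dots> = (\<integral>\<zeta>. a * ((e \<bullet> \<zeta>) * y s \<zeta> powr (- a - 1)) \<partial>\<sigma>)"
    proof (rule Bochner_Integration.integral_cong)
      fix \<zeta> assume "\<zeta> \<in> space \<sigma>"
      then have p: "y s \<zeta> powr (- a) = y s \<zeta> * y s \<zeta> powr (- a - 1)"
        using ypos[of \<zeta> s] powr_add[of "y s \<zeta>" 1 "- a - 1"] by simp
      have "(cosh s)\<^sup>2 = (sinh s)\<^sup>2 + 1" by (rule cosh_square_eq)
      then have "- cosh s * y' s \<zeta> + sinh s * y s \<zeta> = e \<bullet> \<zeta>"
        unfolding y_def y'_def by algebra
      then have "a * (e \<bullet> \<zeta>) * y s \<zeta> powr (- a - 1)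
         = a * (- cosh s * y' s \<zeta> + sinh s * y s \<zeta>) * y s \<zeta> powr (- a - 1)" by simp
      then show "cosh s * g\<^sub>1 s \<zeta> + a * sinh s * y s \<zeta> powr (- a) = a * ((e \<bullet> \<zeta>) * y s \<zeta> powr (- a - 1))"
        unfolding p g\<^sub>1_def by (simp add: algebra_simps)
    qed simp
    finally show ?thesis by simp
  qed
  show "sinh s * (\<integral>\<zeta>. g\<^sub>2 s \<zeta> \<partial>\<sigma>) + ?m * cosh s * (\<integral>\<zeta>. g\<^sub>1 s \<zeta> \<partial>\<sigma>) + a * (?m - a) * sinh s * ?K = 0"
    using parts K1 unfolding K2 by algebra
qed

text \<open>
  The differential equation depends on a only through the product a(n-1-a), which is invariant under
  the exchange of a and n-1-a.
\<close>

lemma hyperbolic_mean_symmetric: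
  assumes e: "norm e = 1" and s: "s \<ge> 0"
  shows "hyperbolic_mean e a s = hyperbolic_mean e (real CARD('n) - 1 - a) s"
proof -
  let ?m = "real CARD('n) - 1"
  let ?b = "?m - a"
  obtain f\<^sub>1 f\<^sub>2 where f: "\<And>s. (hyperbolic_mean e a has_real_derivative f\<^sub>1 s) (at s)"
    "\<And>s. (f\<^sub>1 has_real_derivative f\<^sub>2 s) (at s)"
    "\<And>s. sinh s * f\<^sub>2 s + ?m * cosh s * f\<^sub>1 s + a * (?m - a) * sinh s * hyperbolic_mean e a s = 0"
    using hyperbolic_mean_ode[OF e, of a] by blast
  obtain g\<^sub>1 g\<^sub>2 where g: "\<And>s. (hyperbolic_mean e ?b has_real_derivative g\<^sub>1 s) (at s)"
    "\<And>s. (g\<^sub>1 has_real_derivative g\<^sub>2 s) (at s)"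
    "\<And>s. sinh s * g\<^sub>2 s + ?m * cosh s * g\<^sub>1 s + ?b * (?m - ?b) * sinh s * hyperbolic_mean e ?b s = 0"
    using hyperbolic_mean_ode[OF e, of ?b] by blast
  have "hyperbolic_mean e a s - hyperbolic_mean e ?b s = 0"
  proof (rule radial_ode_unique[where m="?m" and c="a * ?b"
        and f="\<lambda>s. hyperbolic_mean e a s - hyperbolic_mean e ?b s"
        and f\<^sub>1="\<lambda>s. f\<^sub>1 s - g\<^sub>1 s" and f\<^sub>2="\<lambda>s. f\<^sub>2 s - g\<^sub>2 s"])
    show "((\<lambda>s. hyperbolic_mean e a s - hyperbolic_mean e ?b s) has_real_derivative f\<^sub>1 s - g\<^sub>1 s) (at s)" for s
      by (intro DERIV_diff f g)
    show "((\<lambda>s. f\<^sub>1 s - g\<^sub>1 s) has_real_derivative f\<^sub>2 s - g\<^sub>2 s) (at s)" for s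
      by (intro DERIV_diff f g)
    show "sinh s * (f\<^sub>2 s - g\<^sub>2 s) + ?m * cosh s * (f\<^sub>1 s - g\<^sub>1 s)
       + a * ?b * sinh s * (hyperbolic_mean e a s - hyperbolic_mean e ?b s) = 0" for s
      using f(3)[of s] g(3)[of s] by algebra
    show "?m > 0" using dim by simp
  qed (use s in \<open>simp_all add: hyperbolic_mean_def\<close>)
  then show ?thesis by simp
qed

end

section \<open>Distances to the sphere and Riesz means\<close>

text \<open>
  On the interval from d/2 to 2d the derivative p z^(p-1) is comparable with p d^(p-1), and the
  exponent |p-1| of 2 covers both signs of p-1.
\<close>

lemma powr_diff_le:
  fixes d u v p :: real
  assumes d: "d > 0" and u: "d / 2 \<le> u" "u \<le> 2 * d" and v: "d / 2 \<le> v" "v \<le> 2 * d"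
  shows "\<bar>u powr p - v powr p\<bar> \<le> \<bar>p\<bar> * 2 powr \<bar>p - 1\<bar> * d powr (p - 1) * \<bar>u - v\<bar>"
proof -
  have bound: "norm (p * z powr (p - 1)) \<le> \<bar>p\<bar> * 2 powr \<bar>p - 1\<bar> * d powr (p - 1)"
    if z: "z \<in> {d/2..2*d}" for z
  proof -
    have "d / 2 \<le> z" using z by simp
    then have "z > 0" using d by linarith
    then have zd: "z = (z / d) * d" "z / d > 0" using d by simp_all
    have "(z / d) powr (p - 1) = exp ((p - 1) * ln (z / d))"
      using zd(2) d \<open>z > 0\<close> by (simp add: powr_def)
    also have "(p - 1) * ln (z / d) \<le> \<bar>p - 1\<bar> * \<bar>ln (z / d)\<bar>"
      by (metis abs_ge_self abs_mult)
    also have "\<bar>ln (z / d)\<bar> \<le> ln 2"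
    proof -
      have "ln (z / d) \<le> ln 2" using z d zd(2) by (subst ln_le_cancel_iff) (auto simp: divide_simps)
      moreover have "ln (1/2) \<le> ln (z / d)" using z d zd(2) by (subst ln_le_cancel_iff) (auto simp: divide_simps)
      ultimately show ?thesis by (simp add: ln_div)
    qed
    finally have "(z / d) powr (p - 1) \<le> exp (\<bar>p - 1\<bar> * ln 2)"
      by (simp add: mult_left_mono)
    also have "\<dots> = 2 powr \<bar>p - 1\<bar>" by (simp add: powr_def)
    finally have "(z / d) powr (p - 1) * d powr (p - 1) \<le> 2 powr \<bar>p - 1\<bar> * d powr (p - 1)"
      by (simp add: mult_right_mono)
    then have "z powr (p - 1) \<le> 2 powr \<bar>p - 1\<bar> * d powr (p - 1)"
      using powr_mult[of "z / d" d "p - 1"] zd d by simp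
    then show ?thesis by (simp add: abs_mult mult_left_mono mult.assoc)
  qed
  have "norm (u powr p - v powr p) \<le> \<bar>p\<bar> * 2 powr \<bar>p - 1\<bar> * d powr (p - 1) * norm (u - v)"
  proof (rule field_differentiable_bound[of "{d/2..2*d}" _ "\<lambda>z. p * z powr (p - 1)"])
    fix z assume "z \<in> {d/2..2*d}"
    then have "z > 0" using d by auto
    then have "((\<lambda>z. z powr p) has_real_derivative p * z powr (p - 1)) (at z)"
      by (rule has_real_derivative_powr)
    then show "((\<lambda>z. z powr p) has_real_derivative p * z powr (p - 1)) (at z within {d/2..2*d})"
      by (rule DERIV_subset) simp
  qed (use bound u v in auto)
  then show ?thesis by simp
qed

lemma dist_sphere_ge:
  fixes x \<zeta> :: "'a::real_normed_vector"
  assumes "\<zeta> \<in> sphere 0 1"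
  shows "norm (x - \<zeta>) \<ge> 1 - norm x"
  using norm_triangle_ineq2[of \<zeta> x] assms by (simp add: dist_norm norm_minus_commute)

lemma norm_diff_sphere_squared:
  fixes x \<zeta> :: "'a::real_inner"
  assumes "\<zeta> \<in> sphere 0 1"
  shows "(norm (x - \<zeta>))\<^sup>2 = 1 + (norm x)\<^sup>2 - 2 * (x \<bullet> \<zeta>)"
proof -
  have "\<zeta> \<bullet> \<zeta> = 1" using assms by (simp add: dist_norm flip: power2_norm_eq_inner)
  then show ?thesis
    unfolding power2_norm_eq_inner by (simp add: inner_diff inner_commute)
qed

lemma unit_direction:
  fixes x :: "real^'n"
  obtains e where "norm e = 1" "x = norm x *\<^sub>R e"
proof -
  obtain k :: 'n where True by blast
  have "norm (axis k (1::real)) = 1" by (simp add: norm_axis_1)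
  moreover have "norm (x /\<^sub>R norm x) = 1" "x = norm x *\<^sub>R (x /\<^sub>R norm x)" if "x \<noteq> 0"
    using that by simp_all
  ultimately show ?thesis using that by (metis norm_zero scaleR_zero_left)
qed

text \<open>
  Here s is the hyperbolic distance of x from the origin: cosh s = (1+|x|^2)/(1-|x|^2) and
  sinh s = 2|x|/(1-|x|^2).
\<close>

lemma hyperbolic_polar_coordinates:
  fixes x :: "real^'n"
  assumes x: "x \<in> ball 0 1"
  obtains e s where "norm e = 1" "s \<ge> 0"
    "\<And>\<zeta>. \<zeta> \<in> sphere 0 1 \<Longrightarrow> (norm (x - \<zeta>))\<^sup>2 = (1 - (norm x)\<^sup>2) * (cosh s - (e \<bullet> \<zeta>) * sinh s)"
proof -
  define r where "r = norm x"
  obtain e where e1: "norm e = 1" and xe: "x = r *\<^sub>R e"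
    unfolding r_def by (rule unit_direction)
  define w where "w = 1 - r\<^sup>2"
  define s where "s = arsinh (2 * r / w)"
  have r: "0 \<le> r" "r < 1" using x by (auto simp: r_def)
  then have w: "w > 0" by (simp add: w_def power_less_one_iff abs_square_less_1)
  have s0: "s \<ge> 0"
  proof -
    have "0 \<le> sinh s" using r w by (simp add: s_def)
    then show ?thesis by (simp only: sinh_real_nonneg_iff)
  qed
  have sh: "w * sinh s = 2 * r" using w by (simp add: s_def)
  have "(w * cosh s)\<^sup>2 = w\<^sup>2 + (w * sinh s)\<^sup>2"
    by (simp add: power_mult_distrib cosh_square_eq algebra_simps)
  also have "\<dots> = (1 - r\<^sup>2)\<^sup>2 + (2 * r)\<^sup>2" unfolding sh by (simp add: w_def)
  also have "\<dots> = (1 + r\<^sup>2)\<^sup>2" by algebra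
  finally have ch: "w * cosh s = 1 + r\<^sup>2"
    using w by (simp add: power2_eq_iff_nonneg)
  show ?thesis
  proof (rule that[OF e1 s0])
    fix \<zeta> :: "real^'n" assume z: "\<zeta> \<in> sphere 0 1"
    have "(norm (x - \<zeta>))\<^sup>2 = 1 + r\<^sup>2 - 2 * (x \<bullet> \<zeta>)"
      using norm_diff_sphere_squared[OF z] by (simp add: r_def)
    also have "x \<bullet> \<zeta> = r * (e \<bullet> \<zeta>)" by (subst xe) simp
    finally have "(norm (x - \<zeta>))\<^sup>2 = w * cosh s - (e \<bullet> \<zeta>) * (w * sinh s)"
      using ch sh by simp
    then show "(norm (x - \<zeta>))\<^sup>2 = (1 - (norm x)\<^sup>2) * (cosh s - (e \<bullet> \<zeta>) * sinh s)"
      by (simp add: w_def r_def algebra_simps)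
  qed
qed

context rotation_invariant_sphere
begin

definition riesz_mean :: "real \<Rightarrow> real^'n \<Rightarrow> real" where
  "riesz_mean q x = (\<integral>\<zeta>. norm (x - \<zeta>) powr (- q) \<partial>\<sigma>)"

lemma dist_sphere_pos:
  assumes "x \<in> ball 0 1" "\<zeta> \<in> sphere 0 1"
  shows "norm (x - \<zeta>) > 0"
proof -
  have "1 - norm x > 0" using assms(1) by simp
  then show ?thesis using dist_sphere_ge[OF assms(2), of x] by linarith
qed

lemma continuous_on_dist_powr:
  assumes "x \<in> ball 0 1"
  shows "continuous_on (sphere 0 1) (\<lambda>\<zeta>. norm (x - \<zeta>) powr q)"
  using dist_sphere_pos[OF assms] by (intro continuous_on_powr continuous_intros) force

lemma integrable_dist_powr:
  assumes "x \<in> ball 0 1"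
  shows "integrable \<sigma> (\<lambda>\<zeta>. norm (x - \<zeta>) powr q)"
  using continuous_on_dist_powr[OF assms] by (rule integrable_continuous)

lemma riesz_mean_nonneg: "riesz_mean q x \<ge> 0"
  unfolding riesz_mean_def by (rule Bochner_Integration.integral_nonneg) simp

text \<open>
  Since |x-\<zeta>|^2 = (1-|x|^2) y in hyperbolic polar coordinates, (1-|x|^2)^(p/2) times the Riesz mean
  of exponent p is the hyperbolic mean with a = p/2, and the symmetry of hyperbolic means applies.
\<close>

lemma riesz_mean_reflection:
  assumes x: "x \<in> ball 0 1" and pq: "p + q = 2 * (real CARD('n) - 1)"
  shows "(1 - (norm x)\<^sup>2) powr (p / 2) * riesz_mean p x
       = (1 - (norm x)\<^sup>2) powr (q / 2) * riesz_mean q x"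
proof -
  let ?w = "1 - (norm x)\<^sup>2"
  have w: "?w > 0" using x by (simp add: power_less_one_iff abs_square_less_1)
  obtain e s where e: "norm e = 1" "s \<ge> 0"
    and D: "\<And>\<zeta>. \<zeta> \<in> sphere 0 1 \<Longrightarrow> (norm (x - \<zeta>))\<^sup>2 = ?w * (cosh s - (e \<bullet> \<zeta>) * sinh s)"
    using hyperbolic_polar_coordinates[OF x] by blast
  have *: "?w powr (p / 2) * riesz_mean p x = hyperbolic_mean e (p / 2) s" for p
  proof -
    have "?w powr (p / 2) * riesz_mean p x = (\<integral>\<zeta>. ?w powr (p / 2) * norm (x - \<zeta>) powr (- p) \<partial>\<sigma>)"
      by (simp add: riesz_mean_def)
    also have "\<dots> = (\<integral>\<zeta>. (cosh s - (e \<bullet> \<zeta>) * sinh s) powr (- (p / 2)) \<partial>\<sigma>)"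
    proof (rule Bochner_Integration.integral_cong)
      fix \<zeta> assume z: "\<zeta> \<in> space \<sigma>"
      let ?y = "cosh s - (e \<bullet> \<zeta>) * sinh s"
      have pos: "norm (x - \<zeta>) > 0" using dist_sphere_pos[OF x] z by simp
      have y: "?y > 0"
        using D[of \<zeta>] z pos w by (metis space_sigma zero_less_mult_pos zero_less_power)
      have "norm (x - \<zeta>) powr (- p) = ((norm (x - \<zeta>))\<^sup>2) powr (- (p / 2))"
        using pos by (simp add: powr_powr flip: powr_numeral)
      also have "\<dots> = ?w powr (- (p / 2)) * ?y powr (- (p / 2))"
        using D[of \<zeta>] z w y by (simp add: powr_mult)
      finally show "?w powr (p / 2) * norm (x - \<zeta>) powr (- p) = ?y powr (- (p / 2))"
        using w by (simp add: powr_minus)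
    qed simp
    also have "\<dots> = hyperbolic_mean e (p / 2) s" by (simp add: hyperbolic_mean_def)
    finally show ?thesis .
  qed
  have "q / 2 = real CARD('n) - 1 - p / 2" using pq by simp
  then show ?thesis
    unfolding * using hyperbolic_mean_symmetric[OF e, of "p / 2"] by metis
qed

text \<open>
  This is integration by parts with h(t) = D^(-q/2) for D = |x-\<zeta>|^2 = 1 + r^2 - 2rt and r = |x|, where
  t and 1-t^2 are expressed through D by
    4r^2 (1-t^2) = 2(1+r^2) D - D^2 - (1-r^2)^2.
  The last square yields a multiple of the mean with exponent q+2; it is dropped because of its sign.
\<close>

lemma riesz_mean_recurrence:
  fixes x :: "real^'n"
  assumes x: "x \<in> ball 0 1" and q: "q \<ge> 0"
  shows "(real CARD('n) - 1 - q) * (1 + (norm x)\<^sup>2) * riesz_mean q x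
       \<le> (real CARD('n) - 1 - q / 2) * riesz_mean (q - 2) x"
proof -
  let ?m = "real CARD('n) - 1"
  define r where "r = norm x"
  obtain e where e1: "norm e = 1" and xe': "x = r *\<^sub>R e"
    unfolding r_def by (rule unit_direction)
  have r: "0 \<le> r" "r < 1" using x by (auto simp: r_def)
  have xe: "x \<bullet> \<zeta> = r * (e \<bullet> \<zeta>)" for \<zeta> by (subst xe') simp
  define y where "y = (\<lambda>t. 1 + r\<^sup>2 - 2 * r * t)"
  have D: "y (e \<bullet> \<zeta>) = (norm (x - \<zeta>))\<^sup>2" if "\<zeta> \<in> sphere 0 1" for \<zeta>
    using norm_diff_sphere_squared[OF that, of x] by (simp add: y_def r_def[symmetric] xe)
  have ypos: "y t > 0" if "t \<in> {-1..1}" for t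
  proof -
    have "(1 - r)\<^sup>2 > 0" using r by simp
    moreover have "r * t \<le> r * 1" using r that by (intro mult_left_mono) auto
    ultimately show ?thesis by (simp add: y_def power2_eq_square algebra_simps)
  qed
  have parts: "(\<integral>\<zeta>. ?m * ((e \<bullet> \<zeta>) * y (e \<bullet> \<zeta>) powr (- (q / 2))) \<partial>\<sigma>)
      = (\<integral>\<zeta>. (1 - (e \<bullet> \<zeta>)\<^sup>2) * (q * r * y (e \<bullet> \<zeta>) powr (- (q / 2) - 1)) \<partial>\<sigma>)"
  proof (rule integral_zonal_by_parts[OF e1])
    fix t :: real assume t: "t \<in> {-1..1}"
    have d: "(y has_real_derivative - 2 * r) (at t)"
      unfolding y_def by (auto intro!: derivative_eq_intros)
    show "((\<lambda>t. y t powr (- (q / 2))) has_real_derivative q * r * y t powr (- (q / 2) - 1)) (at t)"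
      using DERIV_fun_powr[OF d ypos[OF t], of "- (q / 2)"] by (simp add: algebra_simps)
  next
    show "continuous_on {-1..1} (\<lambda>t. q * r * y t powr (- (q / 2) - 1))"
      using ypos unfolding y_def by (intro continuous_intros) force
  qed
  let ?J = "\<lambda>p. riesz_mean p x"
  have ypow: "y (e \<bullet> \<zeta>) powr (- (q / 2)) = norm (x - \<zeta>) powr (- q)"
      "y (e \<bullet> \<zeta>) * y (e \<bullet> \<zeta>) powr (- (q / 2)) = norm (x - \<zeta>) powr (- (q - 2))"
      if z: "\<zeta> \<in> sphere 0 1" for \<zeta>
  proof -
    have pos: "norm (x - \<zeta>) > 0" using dist_sphere_pos[OF x z] .
    then have sq: "y (e \<bullet> \<zeta>) powr b = norm (x - \<zeta>) powr (2 * b)" for b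
      unfolding D[OF z] by (simp add: powr_powr flip: powr_numeral)
    show "y (e \<bullet> \<zeta>) powr (- (q / 2)) = norm (x - \<zeta>) powr (- q)"
      unfolding sq by simp
    have "y (e \<bullet> \<zeta>) * y (e \<bullet> \<zeta>) powr (- (q / 2)) = y (e \<bullet> \<zeta>) powr (1 - q / 2)"
      using pos D[OF z] powr_add[of "y (e \<bullet> \<zeta>)" 1 "- (q / 2)"] by simp
    then show "y (e \<bullet> \<zeta>) * y (e \<bullet> \<zeta>) powr (- (q / 2)) = norm (x - \<zeta>) powr (- (q - 2))"
      unfolding sq by (simp add: algebra_simps)
  qed
  have bnd: "e \<bullet> \<zeta> \<in> {-1..1}" if "\<zeta> \<in> sphere 0 1" for \<zeta>
    using Cauchy_Schwarz_ineq2[of e \<zeta>] that e1 by (auto simp: dist_norm)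
  have left: "2 * r * (\<integral>\<zeta>. ?m * ((e \<bullet> \<zeta>) * y (e \<bullet> \<zeta>) powr (- (q / 2))) \<partial>\<sigma>)
      = ?m * (1 + r\<^sup>2) * ?J q - ?m * ?J (q - 2)"
  proof -
    have "2 * r * (\<integral>\<zeta>. ?m * ((e \<bullet> \<zeta>) * y (e \<bullet> \<zeta>) powr (- (q / 2))) \<partial>\<sigma>)
       = (\<integral>\<zeta>. 2 * r * (?m * ((e \<bullet> \<zeta>) * y (e \<bullet> \<zeta>) powr (- (q / 2)))) \<partial>\<sigma>)" by simp
    also have "\<dots> = (\<integral>\<zeta>. ?m * (1 + r\<^sup>2) * norm (x - \<zeta>) powr (- q) - ?m * norm (x - \<zeta>) powr (- (q - 2)) \<partial>\<sigma>)"
    proof (rule Bochner_Integration.integral_cong)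
      fix \<zeta> assume "\<zeta> \<in> space \<sigma>"
      then have z: "\<zeta> \<in> sphere 0 1" by simp
      show "2 * r * (?m * ((e \<bullet> \<zeta>) * y (e \<bullet> \<zeta>) powr (- (q / 2))))
          = ?m * (1 + r\<^sup>2) * norm (x - \<zeta>) powr (- q) - ?m * norm (x - \<zeta>) powr (- (q - 2))"
        unfolding ypow[OF z, symmetric] by (simp add: y_def algebra_simps)
    qed simp
    also have "\<dots> = ?m * (1 + r\<^sup>2) * ?J q - ?m * ?J (q - 2)"
      unfolding riesz_mean_def
      by (subst Bochner_Integration.integral_diff) (auto intro!: integrable_dist_powr x)
    finally show ?thesis .
  qed
  have right: "2 * r * (\<integral>\<zeta>. (1 - (e \<bullet> \<zeta>)\<^sup>2) * (q * r * y (e \<bullet> \<zeta>) powr (- (q / 2) - 1)) \<partial>\<sigma>)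
      \<le> q * (1 + r\<^sup>2) * ?J q - q / 2 * ?J (q - 2)"
  proof -
    have "2 * r * (\<integral>\<zeta>. (1 - (e \<bullet> \<zeta>)\<^sup>2) * (q * r * y (e \<bullet> \<zeta>) powr (- (q / 2) - 1)) \<partial>\<sigma>)
       = (\<integral>\<zeta>. 2 * r * ((1 - (e \<bullet> \<zeta>)\<^sup>2) * (q * r * y (e \<bullet> \<zeta>) powr (- (q / 2) - 1))) \<partial>\<sigma>)" by simp
    also have "\<dots> \<le> (\<integral>\<zeta>. q * (1 + r\<^sup>2) * norm (x - \<zeta>) powr (- q) - q / 2 * norm (x - \<zeta>) powr (- (q - 2)) \<partial>\<sigma>)"
    proof (rule integral_mono)
      show "integrable \<sigma> (\<lambda>\<zeta>. 2 * r * ((1 - (e \<bullet> \<zeta>)\<^sup>2) * (q * r * y (e \<bullet> \<zeta>) powr (- (q / 2) - 1))))"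
      proof (intro integrable_continuous continuous_intros)
        show "continuous_on (sphere 0 1) (\<lambda>\<zeta>. y (e \<bullet> \<zeta>))"
          unfolding y_def by (intro continuous_intros)
      qed (use ypos bnd in force)
      show "integrable \<sigma> (\<lambda>\<zeta>. q * (1 + r\<^sup>2) * norm (x - \<zeta>) powr (- q) - q / 2 * norm (x - \<zeta>) powr (- (q - 2)))"
        by (intro Bochner_Integration.integrable_diff integrable_mult_right integrable_dist_powr x)
      fix \<zeta> assume "\<zeta> \<in> space \<sigma>"
      then have z: "\<zeta> \<in> sphere 0 1" by simp
      let ?y = "y (e \<bullet> \<zeta>)"
      let ?p = "?y powr (- (q / 2) - 1)"
      have pos: "?y > 0" using ypos bnd[OF z] by blast
      have p: "?y powr (- (q / 2)) = ?y * ?p"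
        using pos powr_add[of ?y 1 "- (q / 2) - 1"] by simp
      have "4 * r\<^sup>2 * (1 - (e \<bullet> \<zeta>)\<^sup>2) = 2 * (1 + r\<^sup>2) * ?y - ?y\<^sup>2 - (1 - r\<^sup>2)\<^sup>2"
        unfolding y_def by algebra
      also have "\<dots> \<le> 2 * (1 + r\<^sup>2) * ?y - ?y\<^sup>2" by simp
      finally have "q / 2 * ?p * (4 * r\<^sup>2 * (1 - (e \<bullet> \<zeta>)\<^sup>2)) \<le> q / 2 * ?p * (2 * (1 + r\<^sup>2) * ?y - ?y\<^sup>2)"
        using q by (intro mult_left_mono) auto
      then show "2 * r * ((1 - (e \<bullet> \<zeta>)\<^sup>2) * (q * r * ?p))
         \<le> q * (1 + r\<^sup>2) * norm (x - \<zeta>) powr (- q) - q / 2 * norm (x - \<zeta>) powr (- (q - 2))"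
        unfolding ypow[OF z, symmetric] p by (simp add: algebra_simps power2_eq_square)
    qed
    also have "\<dots> = q * (1 + r\<^sup>2) * ?J q - q / 2 * ?J (q - 2)"
      unfolding riesz_mean_def
      by (subst Bochner_Integration.integral_diff) (auto intro!: integrable_dist_powr x)
    finally show ?thesis .
  qed
  have "?m * (1 + r\<^sup>2) * ?J q - ?m * ?J (q - 2) \<le> q * (1 + r\<^sup>2) * ?J q - q / 2 * ?J (q - 2)"
    using right unfolding parts[symmetric] left .
  then show ?thesis by (simp add: r_def algebra_simps)
qed

lemma dist_sphere_le:
  assumes "x \<in> ball 0 1" "\<zeta> \<in> sphere 0 1"
  shows "norm (x - \<zeta>) \<le> 2"
  using norm_triangle_ineq4[of x \<zeta>] assms by (simp add: dist_norm)

text \<open>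
  For 0 \<le> q < n-1 the recurrence bounds the mean of exponent q by that of exponent q-2.  The latter
  is of lower order: |x-\<zeta>|^2 is either at most \<eta>, so that \<eta> times the mean of exponent q can be
  absorbed, or bounded below, so that the integrand is bounded.
\<close>

lemma riesz_mean_bounded:
  assumes q: "q < real CARD('n) - 1"
  obtains C where "C > 0" "\<And>x. x \<in> ball 0 1 \<Longrightarrow> riesz_mean q x \<le> C"
proof -
  let ?m = "real CARD('n) - 1"
  have m: "?m \<ge> 1" using dim by simp
  show ?thesis
  proof (cases "q \<ge> 0")
    case False
    have "riesz_mean q x \<le> 2 powr (- q)" if x: "x \<in> ball 0 1" for x
    proof -
      have "riesz_mean q x \<le> (\<integral>\<zeta>. 2 powr (- q) \<partial>\<sigma>)"
        unfolding riesz_mean_def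
        by (rule integral_mono)
          (use False x dist_sphere_le[OF x] in \<open>auto intro!: integrable_dist_powr powr_mono2\<close>)
      then show ?thesis by simp
    qed
    then show ?thesis by (intro that[of "2 powr (- q)"]) auto
  next
    case True
    \<comment> \<open>Chosen so that (n-1) \<eta> is half of the coefficient n-1-q in the recurrence.\<close>
    define \<eta> where "\<eta> = (?m - q) / (2 * ?m)"
    have \<eta>: "\<eta> > 0" using q m by (simp add: \<eta>_def)
    have le: "riesz_mean q x \<le> 2 * ?m * (4 * \<eta> powr (- (q / 2))) / (?m - q)" if x: "x \<in> ball 0 1" for x
    proof -
      let ?J = "riesz_mean q x"
      have "riesz_mean (q - 2) x \<le> (\<integral>\<zeta>. \<eta> * norm (x - \<zeta>) powr (- q) + 4 * \<eta> powr (- (q / 2)) \<partial>\<sigma>)"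
        unfolding riesz_mean_def
      proof (rule integral_mono)
        fix \<zeta> assume "\<zeta> \<in> space \<sigma>"
        then have z: "\<zeta> \<in> sphere 0 1" by simp
        let ?d = "norm (x - \<zeta>)"
        have d: "?d > 0" "?d\<^sup>2 \<le> 4"
          using dist_sphere_pos[OF x z] dist_sphere_le[OF x z] power_mono[of ?d 2 2] by auto
        have eq: "?d powr (- (q - 2)) = ?d\<^sup>2 * ?d powr (- q)"
          using d powr_add[of ?d 2 "- q"] by (simp add: algebra_simps)
        show "?d powr (- (q - 2)) \<le> \<eta> * ?d powr (- q) + 4 * \<eta> powr (- (q / 2))"
        proof (cases "?d\<^sup>2 \<le> \<eta>")
          case True
          then have "?d\<^sup>2 * ?d powr (- q) \<le> \<eta> * ?d powr (- q)" by (intro mult_right_mono) auto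
          moreover have "0 \<le> 4 * \<eta> powr (- (q / 2))" by simp
          ultimately show ?thesis unfolding eq by linarith
        next
          case False
          have "?d powr (- q) = (?d\<^sup>2) powr (- (q / 2))"
            using d by (simp add: powr_powr flip: powr_numeral)
          also have "\<dots> \<le> \<eta> powr (- (q / 2))"
            using False \<eta> True by (intro powr_mono2') auto
          finally have "?d\<^sup>2 * ?d powr (- q) \<le> 4 * \<eta> powr (- (q / 2))"
            using d by (intro mult_mono) auto
          moreover have "0 \<le> \<eta> * ?d powr (- q)" using \<eta> by simp
          ultimately show ?thesis unfolding eq by linarith
        qed
      qed (use integrable_dist_powr[OF x] in auto)
      also have "\<dots> = \<eta> * ?J + 4 * \<eta> powr (- (q / 2))"
        unfolding riesz_mean_def
        by (subst Bochner_Integration.integral_add) (auto intro!: integrable_dist_powr x)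
      finally have low: "riesz_mean (q - 2) x \<le> \<eta> * ?J + 4 * \<eta> powr (- (q / 2))" .
      have "(?m - q) * 1 * ?J \<le> (?m - q) * (1 + (norm x)\<^sup>2) * ?J"
        using q riesz_mean_nonneg by (intro mult_right_mono mult_left_mono) auto
      also have "\<dots> \<le> (?m - q / 2) * riesz_mean (q - 2) x"
        by (rule riesz_mean_recurrence[OF x True])
      also have "\<dots> \<le> ?m * riesz_mean (q - 2) x"
        using True riesz_mean_nonneg by (intro mult_right_mono) auto
      also have "\<dots> \<le> ?m * (\<eta> * ?J + 4 * \<eta> powr (- (q / 2)))"
        using low m by (intro mult_left_mono) auto
      also have "\<dots> = (?m - q) / 2 * ?J + ?m * (4 * \<eta> powr (- (q / 2)))"
      proof -
        have "?m * \<eta> = (?m - q) / 2" using m by (simp add: \<eta>_def field_simps)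
        then show ?thesis by (metis distrib_left mult.assoc)
      qed
      finally have "(?m - q) * 1 * ?J \<le> (?m - q) / 2 * ?J + ?m * (4 * \<eta> powr (- (q / 2)))" .
      moreover have "(?m - q) * 1 * ?J - (?m - q) / 2 * ?J = (?m - q) * ?J / 2"
        by (simp add: field_simps)
      ultimately have "(?m - q) * ?J \<le> 2 * ?m * (4 * \<eta> powr (- (q / 2)))"
        unfolding mult.assoc[of 2] by linarith
      then show ?thesis using q by (simp add: pos_le_divide_eq mult.commute)
    qed
    have "2 * ?m * (4 * \<eta> powr (- (q / 2))) / (?m - q) > 0"
      using q m \<eta> by (intro divide_pos_pos mult_pos_pos) auto
    then show ?thesis using le by (rule that)
  qed
qed

text \<open>
  For b = 1+\<alpha> the left-hand side is the integral of the kernel of P_\<alpha> up to the constant factor.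
  Classically the identity is the change of variables that sends \<zeta> to the second point of the sphere
  on the line through x and \<zeta>.
\<close>

lemma riesz_mean_kelvin:
  assumes x: "x \<in> ball 0 1"
  shows "(1 - (norm x)\<^sup>2) powr b * riesz_mean (real CARD('n) - 1 + b) x = riesz_mean (real CARD('n) - 1 - b) x"
proof -
  let ?m = "real CARD('n) - 1" and ?w = "1 - (norm x)\<^sup>2"
  have w: "?w > 0" using x by (simp add: power_less_one_iff abs_square_less_1)
  have "?w powr ((?m + b) / 2) = ?w powr ((?m - b) / 2) * ?w powr b"
    using w by (simp flip: powr_add add: field_simps)
  then have "?w powr ((?m - b) / 2) * (?w powr b * riesz_mean (?m + b) x) = ?w powr ((?m - b) / 2) * riesz_mean (?m - b) x"
    using riesz_mean_reflection[OF x, of "?m + b" "?m - b"] by simp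
  then show ?thesis using w by simp
qed

lemma riesz_mean_supercritical_bound:
  assumes b: "b > 0"
  obtains C where "C > 0"
    "\<And>x. x \<in> ball 0 1 \<Longrightarrow> (1 - norm x) powr b * riesz_mean (real CARD('n) - 1 + b) x \<le> C"
proof -
  let ?m = "real CARD('n) - 1"
  obtain C where C: "C > 0" "\<And>x. x \<in> ball 0 1 \<Longrightarrow> riesz_mean (?m - b) x \<le> C"
    using riesz_mean_bounded[of "?m - b"] b by auto
  show ?thesis
  proof (rule that[OF C(1)])
    fix x :: "real^'n" assume x: "x \<in> ball 0 1"
    have "(1 - norm x) * 1 \<le> (1 - norm x) * (1 + norm x)"
      using x by (intro mult_left_mono) auto
    then have "1 - norm x \<le> 1 - (norm x)\<^sup>2" by (simp add: power2_eq_square algebra_simps)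
    then have "(1 - norm x) powr b * riesz_mean (?m + b) x \<le> (1 - (norm x)\<^sup>2) powr b * riesz_mean (?m + b) x"
      using x b riesz_mean_nonneg by (intro mult_right_mono powr_mono2) auto
    also have "\<dots> \<le> C" using riesz_mean_kelvin[OF x] C(2)[OF x] by simp
    finally show "(1 - norm x) powr b * riesz_mean (?m + b) x \<le> C" .
  qed
qed

end

section \<open>Majorants and the Hardy-Littlewood argument\<close>

lemma majorant_mono: "majorant \<omega> \<Longrightarrow> 0 \<le> s \<Longrightarrow> s \<le> t \<Longrightarrow> \<omega> s \<le> \<omega> t"
  unfolding majorant_def by (cases "s = t") (use strict_mono_onD[of "{0..}" \<omega> s t] in simp_all)

lemma majorant_pos: "majorant \<omega> \<Longrightarrow> 0 < t \<Longrightarrow> 0 < \<omega> t"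
  unfolding majorant_def using strict_mono_onD[of "{0..}" \<omega> 0 t] by simp

lemma majorant_nonneg: "majorant \<omega> \<Longrightarrow> 0 \<le> t \<Longrightarrow> 0 \<le> \<omega> t"
  by (simp add: majorant_def)

lemma majorant_quotient_antimono:
  "majorant \<omega> \<Longrightarrow> 0 < s \<Longrightarrow> s \<le> t \<Longrightarrow> \<omega> t / t \<le> \<omega> s / s"
  unfolding majorant_def
  using monotone_onD[of "{0<..}" "(\<le>)" "(\<ge>)" "\<lambda>t. \<omega> t / t" s t] by simp

lemma majorant_double: "majorant \<omega> \<Longrightarrow> 0 < t \<Longrightarrow> \<omega> (2 * t) \<le> 2 * \<omega> t"
  using majorant_quotient_antimono[of \<omega> t "2 * t"] by (simp add: field_simps)

text \<open>
  G(t) is the integral of \<omega>(\<tau>)/\<tau> over (0,t); on (s,t) the integrand is at least \<omega>(s)/t.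
\<close>

lemma fast_majorant_primitive:
  assumes "fast_majorant \<omega>"
  obtains r M G where "r > 0" "M > 0"
    "\<And>s t. 0 < s \<Longrightarrow> s \<le> t \<Longrightarrow> t < r \<Longrightarrow> (t - s) * (\<omega> s / t) \<le> G t - G s"
    "\<And>t. 0 < t \<Longrightarrow> t < r \<Longrightarrow> 0 \<le> G t \<and> G t \<le> M * \<omega> t"
proof -
  have maj: "majorant \<omega>" using assms by (simp add: fast_majorant_def)
  define I where "I = (\<lambda>r. \<integral>\<^sup>+t\<in>{0<..<r}. ennreal (\<omega> t / t) \<partial>lborel)"
  obtain r M where r: "r > 0" and M: "M > 0"
    and I: "\<And>t. 0 < t \<Longrightarrow> t < r \<Longrightarrow> I t \<le> ennreal (M * \<omega> t)"
    using assms unfolding fast_majorant_def I_def by blast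
  have fin: "I t < top" if "0 < t" "t < r" for t
    using I[OF that] by (metis ennreal_less_top le_less_trans)
  have step: "(t - s) * (\<omega> s / t) \<le> enn2real (I t) - enn2real (I s)"
    if st: "0 < s" "s \<le> t" "t < r" for s t
  proof -
    let ?c = "\<omega> s / t"
    have c: "?c \<ge> 0" using majorant_nonneg[OF maj] st by simp
    have "continuous_on {0..} \<omega>" using maj unfolding majorant_def by blast
    then have "continuous_on {0<..<s} \<omega>" by (rule continuous_on_subset) auto
    then have cont: "continuous_on {0<..<s} (\<lambda>x. \<omega> x / x)"
      by (intro continuous_on_divide continuous_on_id) auto
    have meas: "(\<lambda>x. ennreal (\<omega> x / x) * indicator {0<..<s} x) \<in> borel_measurable lborel"
    proof -
      have "(\<lambda>x. ennreal (indicator {0<..<s} x *\<^sub>R (\<omega> x / x))) \<in> borel_measurable borel"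
        using borel_measurable_continuous_on_indicator[OF _ cont] by measurable
      moreover have "(\<lambda>x. ennreal (indicator {0<..<s} x *\<^sub>R (\<omega> x / x)))
          = (\<lambda>x. ennreal (\<omega> x / x) * indicator {0<..<s} x)"
        by (auto simp: fun_eq_iff indicator_def)
      ultimately show ?thesis by simp
    qed
    have "I s + ennreal ((t - s) * ?c) = I s + (\<integral>\<^sup>+x. ennreal ?c * indicator {s..<t} x \<partial>lborel)"
      using st c by (simp add: nn_integral_cmult_indicator ennreal_mult[symmetric] mult.commute)
    also have "\<dots> = (\<integral>\<^sup>+x. ennreal (\<omega> x / x) * indicator {0<..<s} x + ennreal ?c * indicator {s..<t} x \<partial>lborel)"
      unfolding I_def by (rule nn_integral_add[symmetric]) (use meas in auto)
    also have "\<dots> \<le> I t"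
      unfolding I_def
    proof (rule nn_integral_mono)
      fix x :: real
      consider "x \<in> {0<..<s}" | "x \<in> {s..<t}" | "x \<notin> {0<..<s} \<union> {s..<t}" by blast
      then show "ennreal (\<omega> x / x) * indicator {0<..<s} x + ennreal ?c * indicator {s..<t} x
          \<le> ennreal (\<omega> x / x) * indicator {0<..<t} x"
      proof cases
        case 2
        have "\<omega> s / t \<le> \<omega> x / x"
          using 2 st majorant_mono[OF maj, of s x] majorant_nonneg[OF maj, of s]
          by (intro frac_le) auto
        then show ?thesis using 2 st by (auto simp: indicator_def intro: ennreal_leI)
      qed (use st in \<open>auto simp: indicator_def\<close>)
    qed
    finally have le: "I s + ennreal ((t - s) * ?c) \<le> I t" .
    have nn: "(t - s) * ?c \<ge> 0" using st c by (intro mult_nonneg_nonneg) auto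
    have "I s < top" "I t < top" using fin st by auto
    then have "enn2real (I s + ennreal ((t - s) * ?c)) = enn2real (I s) + (t - s) * ?c"
      by (subst enn2real_plus) (use enn2real_ennreal[OF nn] in \<open>auto simp del: times_divide_eq_right\<close>)
    then show ?thesis using enn2real_mono[OF le \<open>I t < top\<close>] by simp
  qed
  show ?thesis
  proof (rule that[OF r M, of "\<lambda>t. enn2real (I t)"])
    show "0 \<le> enn2real (I t) \<and> enn2real (I t) \<le> M * \<omega> t" if "0 < t" "t < r" for t
      using I[OF that] M majorant_nonneg[OF maj, of t] that
      by (auto intro: enn2real_leI)
  qed (use step in blast)
qed

text \<open>
  For unit vectors |a e - b f|^2 = (a-b)^2 + 2ab (1 - e \<bullet> f), and both terms decrease when a and b are
  replaced by a common smaller value.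
\<close>

lemma radial_projection_contracts:
  fixes e f :: "'a::real_inner"
  assumes "norm e = 1" "norm f = 1" and R: "0 \<le> R" "R \<le> a" "R \<le> b"
  shows "norm (R *\<^sub>R e - R *\<^sub>R f) \<le> norm (a *\<^sub>R e - b *\<^sub>R f)"
proof -
  have ee: "e \<bullet> e = 1" "f \<bullet> f = 1" using assms by (simp_all flip: power2_norm_eq_inner)
  have c: "e \<bullet> f \<le> 1" using norm_cauchy_schwarz[of e f] assms by simp
  have "(norm (R *\<^sub>R e - R *\<^sub>R f))\<^sup>2 = 2 * (R * R) * (1 - e \<bullet> f)"
    unfolding power2_norm_eq_inner by (simp add: inner_diff inner_commute ee algebra_simps)
  also have "\<dots> \<le> 2 * (a * b) * (1 - e \<bullet> f)"
    using R c by (intro mult_right_mono mult_left_mono mult_mono) auto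
  also have "\<dots> \<le> 2 * (a * b) * (1 - e \<bullet> f) + (a - b)\<^sup>2" by simp
  also have "\<dots> = (norm (a *\<^sub>R e - b *\<^sub>R f))\<^sup>2"
    unfolding power2_norm_eq_inner
    by (simp add: inner_diff inner_commute ee algebra_simps power2_eq_square)
  finally show ?thesis by (rule power2_le_imp_le) simp
qed

text \<open>
  The local growth estimate covers steps from depth s to depth at most 3s/2, and over such a step the
  increase of G is at least half of \<omega>(s)/s times the length.  Since the increments of G add up, a
  chain of geometrically growing steps loses nothing.
\<close>

lemma radial_oscillation:
  fixes u :: "'a::real_normed_vector \<Rightarrow> real"
  assumes loc: "\<And>x y. \<lbrakk>norm x < 1; norm y < 1; norm (x - y) \<le> (1 - norm x) / 2\<rbrakk>
      \<Longrightarrow> \<bar>u x - u y\<bar> \<le> C * (\<omega> (1 - norm x) / (1 - norm x)) * norm (x - y)"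
    and C: "C \<ge> 0" and nonneg: "\<And>t. t > 0 \<Longrightarrow> \<omega> t \<ge> 0"
    and G: "\<And>s t. 0 < s \<Longrightarrow> s \<le> t \<Longrightarrow> t < r \<Longrightarrow> (t - s) * (\<omega> s / t) \<le> G t - G s"
    and e: "norm e = 1" and st: "0 < s" "s \<le> t" "t \<le> 1" "t < r"
  shows "\<bar>u ((1 - s) *\<^sub>R e) - u ((1 - t) *\<^sub>R e)\<bar> \<le> 2 * C * (G t - G s)"
proof -
  let ?g = "\<lambda>t. u ((1 - t) *\<^sub>R e)"
  have step: "\<bar>?g s - ?g t\<bar> \<le> 2 * C * (G t - G s)"
    if st: "0 < s" "s \<le> t" "t \<le> 1" "t < r" "t \<le> 3 / 2 * s" for s t
  proof -
    have n: "norm ((1 - s) *\<^sub>R e) = 1 - s" "norm ((1 - t) *\<^sub>R e) = 1 - t" using st e by auto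
    have d: "norm ((1 - s) *\<^sub>R e - (1 - t) *\<^sub>R e) = t - s"
      using st e by (simp flip: scaleR_left_diff_distrib)
    have "\<bar>?g s - ?g t\<bar> \<le> C * (\<omega> s / s) * (t - s)"
      using loc[of "(1 - s) *\<^sub>R e" "(1 - t) *\<^sub>R e"] st unfolding n d by simp
    also have "\<dots> \<le> C * (2 * (\<omega> s / t)) * (t - s)"
    proof -
      have "\<omega> s / s \<le> 2 * (\<omega> s / t)"
        using st nonneg[of s] mult_right_mono[of t "2 * s" "\<omega> s"] by (simp add: field_simps)
      then show ?thesis using C st by (intro mult_right_mono mult_left_mono) auto
    qed
    also have "\<dots> = 2 * C * ((t - s) * (\<omega> s / t))" by simp
    also have "\<dots> \<le> 2 * C * (G t - G s)"
      using G[OF st(1,2,4)] C by (intro mult_left_mono) auto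
    finally show ?thesis .
  qed
  have "\<bar>?g s - ?g t\<bar> \<le> 2 * C * (G t - G s)"
    if "s \<le> t" "t \<le> 1" "t < r" "t \<le> (3 / 2) ^ k * s" for k t
    using that
  proof (induction k arbitrary: t)
    case 0
    then show ?case using step[of s t] st(1) by simp
  next
    case (Suc k)
    show ?case
    proof (cases "t \<le> 3 / 2 * s")
      case True
      then show ?thesis using step[of s t] st(1) Suc.prems by simp
    next
      case False
      define p where "p = 2 / 3 * t"
      have p: "s \<le> p" "p \<le> t" "p \<le> (3 / 2) ^ k * s" "t \<le> 3 / 2 * p" "0 < p"
        using False Suc.prems st(1) by (auto simp: p_def)
      have "\<bar>?g s - ?g p\<bar> \<le> 2 * C * (G p - G s)"
        using Suc.IH[of p] p Suc.prems by auto
      moreover have "\<bar>?g p - ?g t\<bar> \<le> 2 * C * (G t - G p)"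
        using step[of p t] p Suc.prems by auto
      moreover have "\<bar>?g s - ?g t\<bar> \<le> \<bar>?g s - ?g p\<bar> + \<bar>?g p - ?g t\<bar>" by simp
      ultimately show ?thesis by (simp add: algebra_simps)
    qed
  qed
  moreover obtain k where "t / s < (3 / 2) ^ k"
    using real_arch_pow[of "3 / 2" "t / s"] by auto
  then have "t \<le> (3 / 2) ^ k * s"
    using st(1) by (simp add: pos_divide_less_eq)
  ultimately show ?thesis using st by blast
qed

text \<open>
  Let L = |x-y|.  If one of the points has depth at least 2L, the local estimate applies to the pair.
  If L is not small, boundedness of u suffices.  Otherwise both points are moved along their radii to
  depth 2L.  Moving costs at most a multiple of G(2L), which is O(\<omega>(2L)) = O(\<omega>(L)) as \<omega> is fast; the
  new points are no farther apart than the old ones, so the local estimate applies to them.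
\<close>

lemma local_growth_imp_Lipschitz_space:
  fixes u :: "real^'n \<Rightarrow> real"
  assumes fast: "fast_majorant \<omega>"
    and bounded: "\<And>x. x \<in> ball 0 1 \<Longrightarrow> \<bar>u x\<bar> \<le> B"
    and C: "C \<ge> 0"
    and loc: "\<And>x y. \<lbrakk>x \<in> ball 0 1; y \<in> ball 0 1; norm (x - y) \<le> (1 - norm x) / 2\<rbrakk>
      \<Longrightarrow> \<bar>u x - u y\<bar> \<le> C * (\<omega> (1 - norm x) / (1 - norm x)) * norm (x - y)"
  shows "u \<in> Lipschitz_space \<omega> (ball 0 1)"
proof -
  have maj: "majorant \<omega>" using fast by (simp add: fast_majorant_def)
  obtain r M G where r: "r > 0" and M: "M > 0"
    and G: "\<And>s t. 0 < s \<Longrightarrow> s \<le> t \<Longrightarrow> t < r \<Longrightarrow> (t - s) * (\<omega> s / t) \<le> G t - G s"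
    and G_bounds: "\<And>t. 0 < t \<Longrightarrow> t < r \<Longrightarrow> 0 \<le> G t \<and> G t \<le> M * \<omega> t"
    using fast_majorant_primitive[OF fast] by blast
  define r\<^sub>1 where "r\<^sub>1 = min r 1 / 2"
  have r1: "r\<^sub>1 > 0" "2 * r\<^sub>1 \<le> r" "2 * r\<^sub>1 \<le> 1" using r by (auto simp: r\<^sub>1_def)
  have B: "B \<ge> 0" using bounded[of 0] by simp
  define K where "K = C + 8 * C * M + 2 * B / \<omega> r\<^sub>1 + 1"
  have K1: "C \<le> K" "C + 8 * C * M \<le> K" "2 * B / \<omega> r\<^sub>1 \<le> K" "K > 0"
  proof -
    have "0 \<le> 8 * C * M" "0 \<le> 2 * B / \<omega> r\<^sub>1"
      using C M B majorant_pos[OF maj r1(1)] by simp_all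
    then show "C \<le> K" "C + 8 * C * M \<le> K" "2 * B / \<omega> r\<^sub>1 \<le> K" "K > 0"
      using C by (simp_all add: K_def)
  qed
  have close: "\<bar>u x - u y\<bar> \<le> C * \<omega> (norm (x - y))"
    if xy: "x \<in> ball 0 1" "y \<in> ball 0 1" "x \<noteq> y" "2 * norm (x - y) \<le> 1 - norm x" for x y
  proof -
    let ?L = "norm (x - y)"
    have L: "?L > 0" using xy by simp
    then have le: "?L \<le> 1 - norm x" using xy(4) by linarith
    have "\<bar>u x - u y\<bar> \<le> C * (\<omega> (1 - norm x) / (1 - norm x)) * ?L"
      using loc xy by simp
    also have "\<dots> \<le> C * (\<omega> ?L / ?L) * ?L"
      using C le L by (intro mult_right_mono mult_left_mono majorant_quotient_antimono[OF maj]) auto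
    finally show ?thesis using L by simp
  qed
  have "\<bar>u x - u y\<bar> \<le> K * \<omega> (norm (x - y))" if xy: "x \<in> ball 0 1" "y \<in> ball 0 1" for x y
  proof (cases "x = y")
    case True
    then show ?thesis using maj unfolding majorant_def by simp
  next
    case False
    let ?L = "norm (x - y)"
    have L: "?L > 0" using False by simp
    then have \<omega>L: "\<omega> ?L > 0" by (rule majorant_pos[OF maj])
    have K: "\<bar>u x - u y\<bar> \<le> K * \<omega> ?L" if "\<bar>u x - u y\<bar> \<le> c * \<omega> ?L" "c \<le> K" for c
      using that \<omega>L mult_right_mono[of c K "\<omega> ?L"] by linarith
    consider "?L \<ge> r\<^sub>1" | "2 * ?L \<le> 1 - norm x" | "2 * ?L \<le> 1 - norm y"
      | "?L < r\<^sub>1" "1 - norm x < 2 * ?L" "1 - norm y < 2 * ?L" by linarith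
    then show ?thesis
    proof cases
      case 1
      have "\<bar>u x - u y\<bar> \<le> 2 * B / \<omega> r\<^sub>1 * \<omega> r\<^sub>1"
        using bounded[OF xy(1)] bounded[OF xy(2)] majorant_pos[OF maj r1(1)] by simp
      also have "\<dots> \<le> 2 * B / \<omega> r\<^sub>1 * \<omega> ?L"
        using 1 r1(1) B majorant_pos[OF maj r1(1)]
        by (intro mult_left_mono majorant_mono[OF maj]) auto
      finally show ?thesis using K1 by (intro K)
    next
      case 2
      then show ?thesis using close[OF xy False] K1 by (intro K)
    next
      case 3
      then show ?thesis
        using close[of y x] xy False K1 K[of C] by (simp add: norm_minus_commute abs_minus_commute)
    next
      case 4
      let ?t = "2 * ?L"
      have t: "?t > 0" "?t < 1" "?t < r" using 4(1) L r1 by linarith+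
      obtain e where e: "norm e = 1" "x = norm x *\<^sub>R e" using unit_direction by blast
      obtain f where f: "norm f = 1" "y = norm y *\<^sub>R f" using unit_direction by blast
      have radial: "\<bar>u z - u ((1 - ?t) *\<^sub>R g)\<bar> \<le> 4 * C * M * \<omega> ?L"
        if z: "z \<in> ball 0 1" "1 - norm z < ?t" and g: "norm g = 1" "z = norm z *\<^sub>R g" for z g
      proof -
        let ?s = "1 - norm z"
        have "\<bar>u ((1 - ?s) *\<^sub>R g) - u ((1 - ?t) *\<^sub>R g)\<bar> \<le> 2 * C * (G ?t - G ?s)"
          by (rule radial_oscillation[where \<omega>=\<omega> and r=r])
            (use loc C G g t z in \<open>auto intro: majorant_nonneg[OF maj]\<close>)
        also have "\<dots> \<le> 2 * C * (M * \<omega> ?t)"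
          using C G_bounds[of ?t] G_bounds[of ?s] t z by (intro mult_left_mono) auto
        also have "\<dots> \<le> 2 * C * (M * (2 * \<omega> ?L))"
          using C M by (intro mult_left_mono majorant_double[OF maj L]) auto
        finally show ?thesis using g(2) by simp
      qed
      let ?x = "(1 - ?t) *\<^sub>R e" and ?y = "(1 - ?t) *\<^sub>R f"
      have "norm (?x - ?y) \<le> norm (norm x *\<^sub>R e - norm y *\<^sub>R f)"
        using e f t 4 by (intro radial_projection_contracts) auto
      then have d: "norm (?x - ?y) \<le> ?L" using e(2) f(2) by simp
      have n: "norm ?x = 1 - ?t" "norm ?y = 1 - ?t" using e f t by auto
      have "\<bar>u ?x - u ?y\<bar> \<le> C * (\<omega> ?t / ?t) * norm (?x - ?y)"
        using loc[of ?x ?y] n d t by simp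
      also have "\<dots> \<le> C * (\<omega> ?L / ?L) * ?L"
        using C d L less_imp_le[OF \<omega>L] majorant_nonneg[OF maj, of ?t]
        by (intro mult_mono mult_left_mono majorant_quotient_antimono[OF maj] mult_nonneg_nonneg) auto
      finally have "\<bar>u ?x - u ?y\<bar> \<le> C * \<omega> ?L" using L by simp
      moreover have "\<bar>u x - u ?x\<bar> \<le> 4 * C * M * \<omega> ?L" "\<bar>u y - u ?y\<bar> \<le> 4 * C * M * \<omega> ?L"
        using radial[OF xy(1) 4(2) e] radial[OF xy(2) 4(3) f] .
      ultimately have "\<bar>u x - u y\<bar> \<le> (C + 8 * C * M) * \<omega> ?L" by (simp add: algebra_simps)
      then show ?thesis using K1 by (intro K)
    qed
  qed
  then show ?thesis unfolding Lipschitz_space_def using K1(4) by blast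
qed

section \<open>The Poisson kernel and the Dirichlet solution\<close>

lemma poisson_kernel_eq:
  fixes x \<zeta> :: "real^'n"
  shows "poisson_kernel \<alpha> x \<zeta> = poisson_const CARD('n) \<alpha> * (1 - (norm x)\<^sup>2) powr (1 + \<alpha>)
     * norm (x - \<zeta>) powr (- (real CARD('n) + \<alpha>))"
  unfolding poisson_kernel_def powr_minus by (simp add: divide_inverse)

context rotation_invariant_sphere
begin

lemma riesz_mean_locally_Lipschitz:
  assumes q: "q + 1 < real CARD('n) - 1"
  obtains C where "C \<ge> 0"
    "\<And>x y. \<lbrakk>x \<in> ball 0 1; y \<in> ball 0 1; norm (x - y) \<le> (1 - norm x) / 2\<rbrakk>
       \<Longrightarrow> \<bar>riesz_mean q x - riesz_mean q y\<bar> \<le> C * norm (x - y)"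
proof -
  obtain B where B: "B > 0" "\<And>x. x \<in> ball 0 1 \<Longrightarrow> riesz_mean (q + 1) x \<le> B"
    using riesz_mean_bounded[OF q] by blast
  let ?K = "\<bar>- q\<bar> * 2 powr \<bar>- q - 1\<bar>"
  show ?thesis
  proof (rule that[of "?K * B"])
    show "?K * B \<ge> 0" using B by simp
    fix x y :: "real^'n"
    assume x: "x \<in> ball 0 1" and y: "y \<in> ball 0 1" and xy: "norm (x - y) \<le> (1 - norm x) / 2"
    have "\<bar>riesz_mean q x - riesz_mean q y\<bar>
        = \<bar>\<integral>\<zeta>. norm (x - \<zeta>) powr (- q) - norm (y - \<zeta>) powr (- q) \<partial>\<sigma>\<bar>"
      unfolding riesz_mean_def
      by (subst Bochner_Integration.integral_diff) (auto intro!: integrable_dist_powr x y)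
    also have "\<dots> \<le> (\<integral>\<zeta>. \<bar>norm (x - \<zeta>) powr (- q) - norm (y - \<zeta>) powr (- q)\<bar> \<partial>\<sigma>)"
      by (rule integral_abs_bound)
    also have "\<dots> \<le> (\<integral>\<zeta>. ?K * norm (x - y) * norm (x - \<zeta>) powr (- (q + 1)) \<partial>\<sigma>)"
    proof (rule integral_mono)
      fix \<zeta> assume "\<zeta> \<in> space \<sigma>"
      then have z: "\<zeta> \<in> sphere 0 1" by simp
      have near: "\<bar>norm (x - \<zeta>) - norm (y - \<zeta>)\<bar> \<le> norm (x - y)"
        using norm_triangle_ineq3[of "x - \<zeta>" "y - \<zeta>"] by simp
      have half: "norm (x - y) \<le> norm (x - \<zeta>) / 2"
        using order_trans[OF xy divide_right_mono[OF dist_sphere_ge[OF z, of x]]] by simp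
      have "\<bar>norm (x - \<zeta>) powr (- q) - norm (y - \<zeta>) powr (- q)\<bar>
         \<le> ?K * norm (x - \<zeta>) powr (- q - 1) * \<bar>norm (x - \<zeta>) - norm (y - \<zeta>)\<bar>"
        using dist_sphere_pos[OF x z] near half by (intro powr_diff_le) linarith+
      also have "\<dots> \<le> ?K * norm (x - \<zeta>) powr (- q - 1) * norm (x - y)"
        using near by (intro mult_left_mono) auto
      finally show "\<bar>norm (x - \<zeta>) powr (- q) - norm (y - \<zeta>) powr (- q)\<bar>
         \<le> ?K * norm (x - y) * norm (x - \<zeta>) powr (- (q + 1))"
        by (simp add: mult_ac)
    qed (intro integrable_abs Bochner_Integration.integrable_diff integrable_mult_right integrable_dist_powr x y)+
    also have "\<dots> = ?K * norm (x - y) * riesz_mean (q + 1) x"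
      by (simp add: riesz_mean_def)
    also have "\<dots> \<le> ?K * norm (x - y) * B"
      using B(2)[OF x] by (intro mult_left_mono) auto
    finally show "\<bar>riesz_mean q x - riesz_mean q y\<bar> \<le> ?K * B * norm (x - y)"
      by (simp add: mult_ac)
  qed
qed

text \<open>
  The singular integral of the kernel becomes a Riesz mean, for \<alpha> > 0 of an exponent below n-2; this
  makes the regularity of P_\<alpha>[1] up to the boundary visible.
\<close>

lemma integral_poisson_kernel:
  assumes x: "x \<in> ball 0 1"
  shows "(\<integral>\<zeta>. poisson_kernel \<alpha> x \<zeta> \<partial>\<sigma>)
       = poisson_const CARD('n) \<alpha> * riesz_mean (real CARD('n) - 2 - \<alpha>) x"
proof -
  have "(\<integral>\<zeta>. poisson_kernel \<alpha> x \<zeta> \<partial>\<sigma>) = poisson_const CARD('n) \<alpha>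
      * ((1 - (norm x)\<^sup>2) powr (1 + \<alpha>) * riesz_mean (real CARD('n) - 1 + (1 + \<alpha>)) x)"
    unfolding poisson_kernel_eq riesz_mean_def by simp
  also have "\<dots> = poisson_const CARD('n) \<alpha> * riesz_mean (real CARD('n) - 2 - \<alpha>) x"
    unfolding riesz_mean_kelvin[OF x] by (simp add: algebra_simps)
  finally show ?thesis .
qed

end

text \<open>
  Replacing x by y with |x-y| \<le> (1-|x|)/2 changes both 1-|x|^2 and |x-\<zeta>| by at most a factor of 2, so
  the mean value theorem for real powers applies to each factor of the kernel.  Differentiating
  the power of |x-\<zeta>| costs a factor 1/|x-\<zeta>|, which is paid for by one of the factors 1-|x|.
\<close>

lemma poisson_kernel_difference:
  fixes \<alpha> :: real
  assumes \<alpha>: "\<alpha> > 0"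
  obtains C where "C \<ge> 0"
    "\<And>x y \<zeta> :: real^'n. \<lbrakk>x \<in> ball 0 1; y \<in> ball 0 1; \<zeta> \<in> sphere 0 1; norm (x - y) \<le> (1 - norm x) / 2\<rbrakk>
       \<Longrightarrow> \<bar>poisson_kernel \<alpha> x \<zeta> - poisson_kernel \<alpha> y \<zeta>\<bar>
         \<le> C * ((1 - norm x) powr \<alpha> * norm (x - \<zeta>) powr (- (real CARD('n) + \<alpha>))) * norm (x - y)"
proof -
  let ?N = "real CARD('n) + \<alpha>"
  define c where "c = \<bar>poisson_const CARD('n) \<alpha>\<bar>"
  define A where "A = (1 + \<alpha>) * 2 powr \<alpha> * 2 powr \<alpha> * 2"
  define B where "B = 4 powr (1 + \<alpha>) * (?N * 2 powr (?N + 1))"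
  have AB: "A \<ge> 0" "B \<ge> 0" using \<alpha> by (auto simp: A_def B_def)
  show ?thesis
  proof (rule that[of "c * (A + B)"])
    show "c * (A + B) \<ge> 0" using AB by (simp add: c_def)
    fix x y \<zeta> :: "real^'n"
    assume x: "x \<in> ball 0 1" and y: "y \<in> ball 0 1" and z: "\<zeta> \<in> sphere 0 1"
      and xy: "norm (x - y) \<le> (1 - norm x) / 2"
    let ?\<delta> = "1 - norm x" and ?d = "norm (x - \<zeta>)" and ?L = "norm (x - y)"
    let ?w = "1 - (norm x)\<^sup>2" and ?v = "1 - (norm y)\<^sup>2"
    let ?E = "?\<delta> powr \<alpha> * ?d powr (- ?N)"
    have \<delta>: "?\<delta> > 0" using x by simp
    have d\<delta>: "?\<delta> \<le> ?d" by (rule dist_sphere_ge[OF z])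
    have d: "?d > 0" using \<delta> d\<delta> by linarith
    have diff: "\<bar>norm x - norm y\<bar> \<le> ?L" by (rule norm_triangle_ineq3)
    have w\<delta>: "?w = ?\<delta> * (1 + norm x)" by (simp add: power2_eq_square algebra_simps)
    have w: "?w > 0" "?w \<le> 2 * ?\<delta>"
      unfolding w\<delta> using \<delta> mult_left_mono[of "1 + norm x" 2 ?\<delta>] mult_pos_pos[of ?\<delta> "1 + norm x"]
      by (auto simp: add_pos_nonneg)
    have vw: "\<bar>?w - ?v\<bar> \<le> ?L * (norm x + norm y)"
    proof -
      have "?w - ?v = (norm y - norm x) * (norm x + norm y)"
        by (simp add: power2_eq_square algebra_simps)
      then have "\<bar>?w - ?v\<bar> = \<bar>norm x - norm y\<bar> * (norm x + norm y)"
        by (simp add: abs_mult abs_minus_commute)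
      then show ?thesis using diff by (simp add: mult_right_mono)
    qed
    have vw1: "\<bar>?w - ?v\<bar> \<le> ?w / 2"
    proof -
      have "?L * (norm x + norm y) \<le> (?\<delta> / 2) * (1 + norm x)"
        using xy \<delta> y by (intro mult_mono) auto
      then show ?thesis using vw unfolding w\<delta> by simp
    qed
    have vw2: "\<bar>?w - ?v\<bar> \<le> 2 * ?L"
      using vw x y mult_left_mono[of "norm x + norm y" 2 ?L] by auto
    have v: "?w / 2 \<le> ?v" "?v \<le> 2 * ?w" using abs_le_D1[OF vw1] abs_le_D2[OF vw1] w by auto
    have "W / 2 \<le> W" "W \<le> 2 * W" if "W > 0" for W :: real using that by auto
    note half_w = this[OF w(1)]
    have first: "\<bar>?w powr (1 + \<alpha>) - ?v powr (1 + \<alpha>)\<bar> \<le> A * ?\<delta> powr \<alpha> * ?L"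
    proof -
      have "\<bar>?w powr (1 + \<alpha>) - ?v powr (1 + \<alpha>)\<bar>
          \<le> \<bar>1 + \<alpha>\<bar> * 2 powr \<bar>1 + \<alpha> - 1\<bar> * ?w powr (1 + \<alpha> - 1) * \<bar>?w - ?v\<bar>"
        by (rule powr_diff_le[OF w(1) half_w v])
      also have "\<dots> = (1 + \<alpha>) * 2 powr \<alpha> * ?w powr \<alpha> * \<bar>?w - ?v\<bar>" using \<alpha> by simp
      also have "\<dots> \<le> (1 + \<alpha>) * 2 powr \<alpha> * (2 powr \<alpha> * ?\<delta> powr \<alpha>) * (2 * ?L)"
      proof -
        have "?w powr \<alpha> \<le> (2 * ?\<delta>) powr \<alpha>" using w \<alpha> by (intro powr_mono2) auto
        also have "\<dots> = 2 powr \<alpha> * ?\<delta> powr \<alpha>" using \<delta> by (subst powr_mult) auto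
        finally show ?thesis using vw2 \<alpha> by (intro mult_mono mult_left_mono) auto
      qed
      finally show ?thesis by (simp add: A_def mult_ac)
    qed
    have second: "?v powr (1 + \<alpha>) * \<bar>?d powr (- ?N) - norm (y - \<zeta>) powr (- ?N)\<bar> \<le> B * ?E * ?L"
    proof -
      have near: "\<bar>?d - norm (y - \<zeta>)\<bar> \<le> ?L"
        using norm_triangle_ineq3[of "x - \<zeta>" "y - \<zeta>"] by simp
      have half: "?L \<le> ?d / 2" using order_trans[OF xy divide_right_mono[OF d\<delta>]] by simp
      have "\<bar>?d powr (- ?N) - norm (y - \<zeta>) powr (- ?N)\<bar>
          \<le> \<bar>- ?N\<bar> * 2 powr \<bar>- ?N - 1\<bar> * ?d powr (- ?N - 1) * \<bar>?d - norm (y - \<zeta>)\<bar>"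
        using d near half by (intro powr_diff_le) linarith+
      also have "\<dots> \<le> \<bar>- ?N\<bar> * 2 powr \<bar>- ?N - 1\<bar> * ?d powr (- ?N - 1) * ?L"
        using near by (intro mult_left_mono) auto
      also have "\<dots> = ?N * 2 powr (?N + 1) * ?d powr (- ?N - 1) * ?L"
      proof -
        have "\<bar>- ?N\<bar> = ?N" "\<bar>- ?N - 1\<bar> = ?N + 1" using \<alpha> by (simp_all add: abs_if)
        then show ?thesis by (simp only:)
      qed
      finally have a: "\<bar>?d powr (- ?N) - norm (y - \<zeta>) powr (- ?N)\<bar>
          \<le> ?N * 2 powr (?N + 1) * ?d powr (- ?N - 1) * ?L" .
      have "?v powr (1 + \<alpha>) \<le> (4 * ?\<delta>) powr (1 + \<alpha>)"
        using v w \<alpha> by (intro powr_mono2) auto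
      also have "\<dots> = 4 powr (1 + \<alpha>) * (?\<delta> * ?\<delta> powr \<alpha>)"
        using \<delta> by (subst powr_mult) (auto simp: powr_add)
      finally have b: "?v powr (1 + \<alpha>) \<le> 4 powr (1 + \<alpha>) * (?\<delta> * ?\<delta> powr \<alpha>)" .
      have "?v powr (1 + \<alpha>) * \<bar>?d powr (- ?N) - norm (y - \<zeta>) powr (- ?N)\<bar>
         \<le> (4 powr (1 + \<alpha>) * (?\<delta> * ?\<delta> powr \<alpha>)) * (?N * 2 powr (?N + 1) * ?d powr (- ?N - 1) * ?L)"
        using a b \<delta> by (intro mult_mono) auto
      also have "\<dots> = B * ?\<delta> powr \<alpha> * (?\<delta> * ?d powr (- ?N - 1)) * ?L"
        by (simp add: B_def mult_ac)
      also have "\<dots> \<le> B * ?\<delta> powr \<alpha> * (?d * ?d powr (- ?N - 1)) * ?L"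
        using d\<delta> AB by (intro mult_right_mono mult_left_mono mult_nonneg_nonneg) auto
      also have "?d * ?d powr (- ?N - 1) = ?d powr (- ?N)"
        using d powr_add[of ?d 1 "- ?N - 1"] by simp
      finally show ?thesis by (simp add: mult_ac)
    qed
    have "poisson_kernel \<alpha> x \<zeta> - poisson_kernel \<alpha> y \<zeta> = poisson_const CARD('n) \<alpha> *
        ((?w powr (1 + \<alpha>) - ?v powr (1 + \<alpha>)) * ?d powr (- ?N)
          + ?v powr (1 + \<alpha>) * (?d powr (- ?N) - norm (y - \<zeta>) powr (- ?N)))"
      unfolding poisson_kernel_eq by algebra
    then have "\<bar>poisson_kernel \<alpha> x \<zeta> - poisson_kernel \<alpha> y \<zeta>\<bar> = c *
        \<bar>(?w powr (1 + \<alpha>) - ?v powr (1 + \<alpha>)) * ?d powr (- ?N)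
          + ?v powr (1 + \<alpha>) * (?d powr (- ?N) - norm (y - \<zeta>) powr (- ?N))\<bar>"
      by (simp add: c_def abs_mult)
    also have "\<dots> \<le> c * (A * ?\<delta> powr \<alpha> * ?L * ?d powr (- ?N) + B * ?E * ?L)"
    proof (rule mult_left_mono)
      show "\<bar>(?w powr (1 + \<alpha>) - ?v powr (1 + \<alpha>)) * ?d powr (- ?N)
          + ?v powr (1 + \<alpha>) * (?d powr (- ?N) - norm (y - \<zeta>) powr (- ?N))\<bar>
          \<le> A * ?\<delta> powr \<alpha> * ?L * ?d powr (- ?N) + B * ?E * ?L"
      proof (rule order_trans[OF abs_triangle_ineq add_mono])
        show "\<bar>(?w powr (1 + \<alpha>) - ?v powr (1 + \<alpha>)) * ?d powr (- ?N)\<bar> \<le> A * ?\<delta> powr \<alpha> * ?L * ?d powr (- ?N)"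
          using mult_right_mono[OF first, of "?d powr (- ?N)"] by (simp add: abs_mult)
        show "\<bar>?v powr (1 + \<alpha>) * (?d powr (- ?N) - norm (y - \<zeta>) powr (- ?N))\<bar> \<le> B * ?E * ?L"
          using second by (simp add: abs_mult)
      qed
    qed (simp add: c_def)
    also have "\<dots> = c * (A + B) * ?E * ?L" by (simp add: algebra_simps)
    finally show "\<bar>poisson_kernel \<alpha> x \<zeta> - poisson_kernel \<alpha> y \<zeta>\<bar> \<le> c * (A + B) * ?E * ?L" .
  qed
qed

lemma Lipschitz_space_imp_continuous_on:
  assumes maj: "majorant \<omega>" and \<phi>: "\<phi> \<in> Lipschitz_space \<omega> \<Omega>"
  shows "continuous_on \<Omega> \<phi>"
proof -
  obtain M where M: "\<And>x y. x \<in> \<Omega> \<Longrightarrow> y \<in> \<Omega> \<Longrightarrow> \<bar>\<phi> x - \<phi> y\<bar> \<le> M * \<omega> (norm (x - y))"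
    using \<phi> unfolding Lipschitz_space_def by blast
  show ?thesis
    unfolding continuous_on
  proof
    fix x assume x: "x \<in> \<Omega>"
    have cont: "continuous_on {0..} \<omega>" and zero: "\<omega> 0 = 0"
      using maj unfolding majorant_def by blast+
    have "continuous_on UNIV (\<lambda>y. \<omega> (norm (y - x)))"
      by (rule continuous_on_compose2[OF cont]) (auto intro!: continuous_intros)
    then have "((\<lambda>y. \<omega> (norm (y - x))) \<longlongrightarrow> \<omega> (norm (x - x))) (at x within \<Omega>)"
      by (meson UNIV_I continuous_on_def continuous_on_subset subset_UNIV tendsto_within_subset)
    then have lim: "((\<lambda>y. M * \<omega> (norm (y - x))) \<longlongrightarrow> 0) (at x within \<Omega>)"
      by (intro tendsto_mult_right_zero) (simp add: zero)
    have "((\<lambda>y. \<phi> y - \<phi> x) \<longlongrightarrow> 0) (at x within \<Omega>)"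
      by (rule Lim_null_comparison[OF _ lim])
        (use M x in \<open>auto simp: eventually_at_filter intro!: always_eventually\<close>)
    then show "(\<phi> \<longlongrightarrow> \<phi> x) (at x within \<Omega>)" by (simp add: LIM_zero_iff)
  qed
qed

context rotation_invariant_sphere
begin

text \<open>
  The splitting subtracts \<phi>(\<eta>) at the radial projection \<eta> of x.  The contribution of U = P_\<alpha>[1] is
  Lipschitz, which suffices because \<omega>(\<delta>)/\<delta> \<ge> \<omega>(1) > 0 for \<delta> \<le> 1.
\<close>

lemma dirichlet_sol_local_growth:
  fixes \<phi> :: "real^'n \<Rightarrow> real"
  assumes \<alpha>: "\<alpha> > 0" and maj: "majorant \<omega>" and \<phi>: "\<phi> \<in> Lipschitz_space \<omega> (sphere 0 1)"
  obtains C where "C \<ge> 0"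
    "\<And>x y. \<lbrakk>x \<in> ball 0 1; y \<in> ball 0 1; norm (x - y) \<le> (1 - norm x) / 2\<rbrakk>
      \<Longrightarrow> \<bar>dirichlet_sol \<sigma> \<alpha> \<phi> x - dirichlet_sol \<sigma> \<alpha> \<phi> y\<bar>
        \<le> C * (\<omega> (1 - norm x) / (1 - norm x)) * norm (x - y)"
proof -
  let ?n = "real CARD('n)" and ?P = "poisson_kernel \<alpha> :: real^'n \<Rightarrow> _" and ?u = "dirichlet_sol \<sigma> \<alpha> \<phi>"
  obtain M where M: "M > 0"
    and lip: "\<And>x y. x \<in> sphere 0 1 \<Longrightarrow> y \<in> sphere 0 1 \<Longrightarrow> \<bar>\<phi> x - \<phi> y\<bar> \<le> M * \<omega> (norm (x - y))"
    using \<phi> unfolding Lipschitz_space_def by blast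
  have cont: "continuous_on (sphere 0 1) \<phi>"
    using maj \<phi> by (rule Lipschitz_space_imp_continuous_on)
  have "compact (\<phi> ` sphere 0 1)" using cont by (rule compact_continuous_image) simp
  then obtain S where S: "\<And>\<zeta>. \<zeta> \<in> sphere 0 1 \<Longrightarrow> \<bar>\<phi> \<zeta>\<bar> \<le> S"
    by (metis bounded_iff compact_imp_bounded imageI real_norm_def)
  obtain A where A: "A \<ge> 0"
    and diff: "\<And>x y \<zeta> :: real^'n. \<lbrakk>x \<in> ball 0 1; y \<in> ball 0 1; \<zeta> \<in> sphere 0 1; norm (x - y) \<le> (1 - norm x) / 2\<rbrakk>
       \<Longrightarrow> \<bar>?P x \<zeta> - ?P y \<zeta>\<bar>
         \<le> A * ((1 - norm x) powr \<alpha> * norm (x - \<zeta>) powr (- (?n + \<alpha>))) * norm (x - y)"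
    using poisson_kernel_difference[OF \<alpha>] by blast
  obtain B where B: "B > 0"
    and sharp: "\<And>x. x \<in> ball 0 1 \<Longrightarrow> (1 - norm x) powr \<alpha> * riesz_mean (?n - 1 + \<alpha>) x \<le> B"
    using riesz_mean_supercritical_bound[OF \<alpha>] by blast
  obtain D where D: "D \<ge> 0"
    and mass: "\<And>x y. \<lbrakk>x \<in> ball 0 1; y \<in> ball 0 1; norm (x - y) \<le> (1 - norm x) / 2\<rbrakk>
       \<Longrightarrow> \<bar>riesz_mean (?n - 2 - \<alpha>) x - riesz_mean (?n - 2 - \<alpha>) y\<bar> \<le> D * norm (x - y)"
    using riesz_mean_locally_Lipschitz[of "?n - 2 - \<alpha>"] \<alpha> by auto
  define c where "c = \<bar>poisson_const CARD('n) \<alpha>\<bar>"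
  have \<omega>1: "\<omega> 1 > 0" using majorant_pos[OF maj] by simp
  show ?thesis
  proof (rule that[of "2 * A * M * B + \<bar>S\<bar> * c * D / \<omega> 1"])
    show "2 * A * M * B + \<bar>S\<bar> * c * D / \<omega> 1 \<ge> 0" using A M B D \<omega>1 by (simp add: c_def)
    fix x y :: "real^'n"
    assume x: "x \<in> ball 0 1" and y: "y \<in> ball 0 1" and xy: "norm (x - y) \<le> (1 - norm x) / 2"
    let ?\<delta> = "1 - norm x" and ?L = "norm (x - y)"
    let ?Q = "\<omega> ?\<delta> / ?\<delta>"
    have \<delta>: "?\<delta> > 0" "?\<delta> \<le> 1" using x by auto
    have Q: "?Q \<ge> 0" using majorant_nonneg[OF maj, of ?\<delta>] \<delta> by simp
    obtain \<eta> where \<eta>: "norm \<eta> = 1" "x = norm x *\<^sub>R \<eta>" by (rule unit_direction)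
    have \<eta>s: "\<eta> \<in> sphere 0 1" using \<eta> by simp
    have x\<eta>: "norm (x - \<eta>) = ?\<delta>"
    proof -
      have "x - \<eta> = - (?\<delta> *\<^sub>R \<eta>)" using \<eta>(2) by (simp add: algebra_simps)
      then have "norm (x - \<eta>) = \<bar>?\<delta>\<bar> * norm \<eta>" by (metis norm_minus_cancel norm_scaleR)
      then show ?thesis using \<eta>(1) \<delta> by simp
    qed
    \<comment> \<open>If x = 0, then \<eta> is an arbitrary boundary point, and |x - \<eta>| = 1 is still the depth of x.\<close>
    have osc: "\<bar>\<phi> \<zeta> - \<phi> \<eta>\<bar> \<le> M * (2 * norm (x - \<zeta>) * ?Q)" if z: "\<zeta> \<in> sphere 0 1" for \<zeta>
    proof -
      let ?d = "norm (x - \<zeta>)"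
      have d: "?\<delta> \<le> ?d" by (rule dist_sphere_ge[OF z])
      have "norm (\<zeta> - \<eta>) \<le> 2 * ?d"
        using norm_triangle_ineq4[of "x - \<eta>" "x - \<zeta>"] x\<eta> d by simp
      then have "\<omega> (norm (\<zeta> - \<eta>)) \<le> \<omega> (2 * ?d)" by (intro majorant_mono[OF maj]) auto
      also have "\<dots> = 2 * ?d * (\<omega> (2 * ?d) / (2 * ?d))" using dist_sphere_pos[OF x z] by simp
      also have "\<dots> \<le> 2 * ?d * ?Q"
        using d \<delta> by (intro mult_left_mono majorant_quotient_antimono[OF maj]) auto
      finally have "M * \<omega> (norm (\<zeta> - \<eta>)) \<le> M * (2 * ?d * ?Q)"
        using M by (intro mult_left_mono) auto
      then show ?thesis using lip[OF z \<eta>s] by linarith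
    qed
    have int: "integrable \<sigma> (\<lambda>\<zeta>. ?P v \<zeta> * \<phi> \<zeta>)" "integrable \<sigma> (?P v)" if v: "v \<in> ball 0 1" for v
    proof -
      have "continuous_on (sphere 0 1) (?P v)"
        unfolding poisson_kernel_def using dist_sphere_pos[OF v] by (intro continuous_intros) force+
      then show "integrable \<sigma> (\<lambda>\<zeta>. ?P v \<zeta> * \<phi> \<zeta>)" "integrable \<sigma> (?P v)"
        using cont by (auto intro!: integrable_continuous continuous_intros)
    qed
    let ?I = "\<lambda>v. \<integral>\<zeta>. ?P v \<zeta> \<partial>\<sigma>"
    have split: "?u x - ?u y = (\<integral>\<zeta>. (?P x \<zeta> - ?P y \<zeta>) * (\<phi> \<zeta> - \<phi> \<eta>) \<partial>\<sigma>) + \<phi> \<eta> * (?I x - ?I y)"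
    proof -
      have "(\<integral>\<zeta>. (?P x \<zeta> - ?P y \<zeta>) * (\<phi> \<zeta> - \<phi> \<eta>) \<partial>\<sigma>)
        = (\<integral>\<zeta>. (?P x \<zeta> * \<phi> \<zeta> - ?P y \<zeta> * \<phi> \<zeta>) - (\<phi> \<eta> * ?P x \<zeta> - \<phi> \<eta> * ?P y \<zeta>) \<partial>\<sigma>)"
        by (simp add: algebra_simps)
      also have "\<dots> = (?u x - ?u y) - (\<phi> \<eta> * ?I x - \<phi> \<eta> * ?I y)"
        unfolding dirichlet_sol_def
        using int[OF x] int[OF y] by simp
      finally show ?thesis by (simp add: algebra_simps)
    qed
    have "\<bar>\<integral>\<zeta>. (?P x \<zeta> - ?P y \<zeta>) * (\<phi> \<zeta> - \<phi> \<eta>) \<partial>\<sigma>\<bar> \<le> (\<integral>\<zeta>. \<bar>(?P x \<zeta> - ?P y \<zeta>) * (\<phi> \<zeta> - \<phi> \<eta>)\<bar> \<partial>\<sigma>)"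
      by (rule integral_abs_bound)
    also have "\<dots> \<le> (\<integral>\<zeta>. 2 * A * M * ?Q * ?L * ?\<delta> powr \<alpha> * norm (x - \<zeta>) powr (- (?n - 1 + \<alpha>)) \<partial>\<sigma>)"
    proof (rule integral_mono)
      have "integrable \<sigma> (\<lambda>\<zeta>. (?P x \<zeta> * \<phi> \<zeta> - ?P y \<zeta> * \<phi> \<zeta>) - (\<phi> \<eta> * ?P x \<zeta> - \<phi> \<eta> * ?P y \<zeta>))"
        using int[OF x] int[OF y] by auto
      then show "integrable \<sigma> (\<lambda>\<zeta>. \<bar>(?P x \<zeta> - ?P y \<zeta>) * (\<phi> \<zeta> - \<phi> \<eta>)\<bar>)"
        by (intro integrable_abs) (simp add: algebra_simps)
      show "integrable \<sigma> (\<lambda>\<zeta>. 2 * A * M * ?Q * ?L * ?\<delta> powr \<alpha> * norm (x - \<zeta>) powr (- (?n - 1 + \<alpha>)))"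
        by (intro integrable_mult_right integrable_dist_powr x)
      fix \<zeta> assume "\<zeta> \<in> space \<sigma>"
      then have z: "\<zeta> \<in> sphere 0 1" by simp
      let ?d = "norm (x - \<zeta>)"
      have p: "?d * ?d powr (- (?n + \<alpha>)) = ?d powr (- (?n - 1 + \<alpha>))"
        using dist_sphere_pos[OF x z] powr_add[of ?d 1 "- (?n + \<alpha>)"] by (simp add: algebra_simps)
      have "\<bar>(?P x \<zeta> - ?P y \<zeta>) * (\<phi> \<zeta> - \<phi> \<eta>)\<bar>
         \<le> (A * (?\<delta> powr \<alpha> * ?d powr (- (?n + \<alpha>))) * ?L) * (M * (2 * ?d * ?Q))"
        unfolding abs_mult using diff[OF x y z xy] osc[OF z] A
        by (intro mult_mono) auto
      also have "\<dots> = 2 * A * M * ?Q * ?L * ?\<delta> powr \<alpha> * (?d * ?d powr (- (?n + \<alpha>)))" by simp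
      finally show "\<bar>(?P x \<zeta> - ?P y \<zeta>) * (\<phi> \<zeta> - \<phi> \<eta>)\<bar>
         \<le> 2 * A * M * ?Q * ?L * ?\<delta> powr \<alpha> * ?d powr (- (?n - 1 + \<alpha>))" unfolding p .
    qed
    also have "\<dots> = 2 * A * M * ?Q * ?L * (?\<delta> powr \<alpha> * riesz_mean (?n - 1 + \<alpha>) x)"
      by (simp add: riesz_mean_def)
    also have "\<dots> \<le> 2 * A * M * ?Q * ?L * B"
      using sharp[OF x] A M Q by (intro mult_left_mono mult_nonneg_nonneg) auto
    finally have first: "\<bar>\<integral>\<zeta>. (?P x \<zeta> - ?P y \<zeta>) * (\<phi> \<zeta> - \<phi> \<eta>) \<partial>\<sigma>\<bar> \<le> 2 * A * M * B * ?Q * ?L"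
      by (simp add: mult_ac)
    have "\<bar>\<phi> \<eta> * (?I x - ?I y)\<bar> = \<bar>\<phi> \<eta>\<bar> * (c * \<bar>riesz_mean (?n - 2 - \<alpha>) x - riesz_mean (?n - 2 - \<alpha>) y\<bar>)"
      unfolding integral_poisson_kernel[OF x] integral_poisson_kernel[OF y] c_def
      by (simp add: abs_mult flip: right_diff_distrib)
    also have "\<dots> \<le> \<bar>S\<bar> * (c * (D * ?L))"
      using S[OF \<eta>s] mass[OF x y xy] by (intro mult_mono mult_left_mono) (auto simp: c_def)
    also have "\<dots> = \<bar>S\<bar> * c * D / \<omega> 1 * \<omega> 1 * ?L" using \<omega>1 by simp
    also have "\<dots> \<le> \<bar>S\<bar> * c * D / \<omega> 1 * ?Q * ?L"
      using majorant_quotient_antimono[OF maj \<delta>] D \<omega>1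
      by (intro mult_right_mono mult_left_mono) (auto simp: c_def)
    finally have second: "\<bar>\<phi> \<eta> * (?I x - ?I y)\<bar> \<le> \<bar>S\<bar> * c * D / \<omega> 1 * ?Q * ?L" .
    have "\<bar>?u x - ?u y\<bar> \<le> 2 * A * M * B * ?Q * ?L + \<bar>S\<bar> * c * D / \<omega> 1 * ?Q * ?L"
      unfolding split using first second by linarith
    also have "\<dots> = (2 * A * M * B + \<bar>S\<bar> * c * D / \<omega> 1) * ?Q * ?L" by (simp only: distrib_right)
    finally show "\<bar>?u x - ?u y\<bar> \<le> (2 * A * M * B + \<bar>S\<bar> * c * D / \<omega> 1) * ?Q * ?L" .
  qed
qed

text \<open>
  The kernel has the sign of its constant factor, so its absolute value integrates to a multiple of a
  bounded Riesz mean.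
\<close>

lemma dirichlet_sol_bounded:
  fixes \<phi> :: "real^'n \<Rightarrow> real"
  assumes \<alpha>: "\<alpha> > 0" and cont: "continuous_on (sphere 0 1) \<phi>"
  obtains B where "\<And>x. x \<in> ball 0 1 \<Longrightarrow> \<bar>dirichlet_sol \<sigma> \<alpha> \<phi> x\<bar> \<le> B"
proof -
  have "compact (\<phi> ` sphere 0 1)" using cont by (rule compact_continuous_image) simp
  then obtain S where S: "\<And>\<zeta>. \<zeta> \<in> sphere 0 1 \<Longrightarrow> \<bar>\<phi> \<zeta>\<bar> \<le> S"
    by (metis bounded_iff compact_imp_bounded imageI real_norm_def)
  let ?q = "real CARD('n) - 2 - \<alpha>" and ?c = "poisson_const CARD('n) \<alpha>"
  obtain K where K: "K > 0" "\<And>x. x \<in> ball 0 1 \<Longrightarrow> riesz_mean ?q x \<le> K"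
    using riesz_mean_bounded[of ?q] \<alpha> by auto
  have "\<bar>dirichlet_sol \<sigma> \<alpha> \<phi> x\<bar> \<le> \<bar>S\<bar> * (\<bar>?c\<bar> * K)" if x: "x \<in> ball 0 1" for x
  proof -
    let ?P = "poisson_kernel \<alpha> x"
    have contP: "continuous_on (sphere 0 1) ?P"
      unfolding poisson_kernel_def using dist_sphere_pos[OF x] by (intro continuous_intros) force+
    have absP: "\<bar>?P \<zeta>\<bar> = sgn ?c * ?P \<zeta>" for \<zeta>
    proof -
      have "?P \<zeta> = ?c * ((1 - (norm x)\<^sup>2) powr (1 + \<alpha>) / norm (x - \<zeta>) powr (real CARD('n) + \<alpha>))"
        by (simp add: poisson_kernel_def)
      moreover have "sgn ?c * ?c = \<bar>?c\<bar>" by (simp add: abs_sgn mult.commute)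
      ultimately show ?thesis by (simp only: abs_mult mult.assoc[symmetric]) simp
    qed
    have "\<bar>dirichlet_sol \<sigma> \<alpha> \<phi> x\<bar> \<le> (\<integral>\<zeta>. \<bar>?P \<zeta> * \<phi> \<zeta>\<bar> \<partial>\<sigma>)"
      unfolding dirichlet_sol_def by (rule integral_abs_bound)
    also have "\<dots> \<le> (\<integral>\<zeta>. \<bar>S\<bar> * (sgn ?c * ?P \<zeta>) \<partial>\<sigma>)"
    proof (rule integral_mono)
      show "integrable \<sigma> (\<lambda>\<zeta>. \<bar>?P \<zeta> * \<phi> \<zeta>\<bar>)" "integrable \<sigma> (\<lambda>\<zeta>. \<bar>S\<bar> * (sgn ?c * ?P \<zeta>))"
        using contP cont by (auto intro!: integrable_continuous continuous_intros)
      fix \<zeta> assume "\<zeta> \<in> space \<sigma>"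
      then have "\<bar>\<phi> \<zeta>\<bar> \<le> \<bar>S\<bar>" using S[of \<zeta>] by simp
      then show "\<bar>?P \<zeta> * \<phi> \<zeta>\<bar> \<le> \<bar>S\<bar> * (sgn ?c * ?P \<zeta>)"
        unfolding absP[symmetric] abs_mult by (simp add: mult.commute mult_right_mono)
    qed
    also have "\<dots> = \<bar>S\<bar> * (\<bar>?c\<bar> * riesz_mean ?q x)"
      by (simp add: integral_poisson_kernel[OF x] abs_sgn mult_ac)
    also have "\<dots> \<le> \<bar>S\<bar> * (\<bar>?c\<bar> * K)"
      using K(2)[OF x] by (intro mult_left_mono) auto
    finally show ?thesis .
  qed
  then show ?thesis by (rule that)
qed

end

theorem theorem2p1:
  fixes \<alpha> :: real and \<omega> :: "real \<Rightarrow> real"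
    and \<sigma> :: "(real^'n) measure" and \<phi> :: "real^'n \<Rightarrow> real"
  assumes "CARD('n) \<ge> 2"
    and "\<alpha> > 0"
    and "normalized_sphere_measure \<sigma>"
    and "fast_majorant \<omega>"
    and "\<phi> \<in> Lipschitz_space \<omega> (sphere 0 1)"
  shows "dirichlet_sol \<sigma> \<alpha> \<phi> \<in> Lipschitz_space \<omega> (ball 0 1)"
proof -
  interpret rotation_invariant_sphere \<sigma>
    using assms(1,3) by unfold_locales
  have maj: "majorant \<omega>" using assms(4) by (simp add: fast_majorant_def)
  obtain B where B: "\<And>x. x \<in> ball 0 1 \<Longrightarrow> \<bar>dirichlet_sol \<sigma> \<alpha> \<phi> x\<bar> \<le> B"
    using dirichlet_sol_bounded[OF assms(2) Lipschitz_space_imp_continuous_on[OF maj assms(5)]] by blast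
  obtain C where C: "C \<ge> 0"
    "\<And>x y. \<lbrakk>x \<in> ball 0 1; y \<in> ball 0 1; norm (x - y) \<le> (1 - norm x) / 2\<rbrakk>
      \<Longrightarrow> \<bar>dirichlet_sol \<sigma> \<alpha> \<phi> x - dirichlet_sol \<sigma> \<alpha> \<phi> y\<bar>
        \<le> C * (\<omega> (1 - norm x) / (1 - norm x)) * norm (x - y)"
    using dirichlet_sol_local_growth[OF assms(2) maj assms(5)] by blast
  show ?thesis
    using assms(4) B C by (rule local_growth_imp_Lipschitz_space)
qed

end
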